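(* Let $t$ and $k$ be positive integers, and let $c$ be the maximum of $\chi(G)$ over all $K_k$-free graphs $G$ of tree-width at most $t$. There exists an on-line coloring algorithm $\mathcal{A}_t$ such that every $K_k$-free graph $H$ that has a nice path decomposition $(P,\beta)$ of width at most $t$ satisfies $\chi_{\mathcal{A}_t}(H,P,\beta)\le c$. Conversely, if an on-line coloring algorithm $\mathcal{A}'_t$ satisfies $\chi_{\mathcal{A}'_t}(H,P,\beta)\le c'$ for every $K_k$-free graph $H$ having a nice path decomposition $(P,\beta)$ of width at most $t$ (and every such decomposition), then $\chi(G)\le c'$ for every $K_k$-free graph $G$ of tree-width at most $t$.
   Context: Graphs are finite and simple; $\chi(G)$ is the chromatic number; a graph is $K_k$-free if it does not contain the complete graph on $k$ vertices as a subgraph. A tree decomposition of a graph $G$ is a pair $(T,\beta)$, where $T$ is a tree and $\beta$ assigns to each vertex of $T$ a set of vertices of $G$, such that for every $uv\in E(G)$ there exists $z\in V(T)$ with $\{u,v\}\subseteq\beta(z)$, and for every $v\in V(G)$ the set $\{z\in V(T):v\in\beta(z)\}$ induces a non-empty connected subtree of $T$. Its width is the maximum of $|\beta(z)|-1$ over all $z\in V(T)$, and the tree-width of $G$ is the minimum width of a tree decomposition of $G$. A path decomposition is a tree decomposition $(P,\beta)$ where $P$ is a path. A path decomposition $(P,\beta)$ with $P=z_0z_1\ldots z_n$ (the path being taken in this order) is nice if $\beta(z_0)=\emptyset$ and $|\beta(z_i)\setminus\beta(z_{i-1})|=1$ for $i=1,\dots,n$. An on-line coloring algorithm $\mathcal{A}$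 is a function from the set of triples $(H,Q,\gamma)$, where $H$ is a graph with a nice path decomposition $(Q,\gamma)$, to the integers, such that the following holds. Consider any graph $G$ with a nice path decomposition $(P,\beta)$, where $P=z_0z_1\ldots z_n$ for some $n\ge 1$. For $i=1,\ldots,n$, let $v_i$ be the unique vertex in $\beta(z_i)\setminus\beta(z_{i-1})$, let $P_i=P-\{z_{i+1},\ldots,z_n\}$, $G_i=G-\{v_{i+1},\ldots,v_n\}$, and let $\beta_i$ be the restriction of $\beta$ to $V(P_i)$. If $\varphi:V(G)\to\mathbf{Z}$ is defined by $\varphi(v_i)=\mathcal{A}(G_i,P_i,\beta_i)$, then $\varphi$ is a proper coloring of $G$. This $\varphi$ is the coloring of $G$ produced by $\mathcal{A}$, and $\chi_{\mathcal{A}}(G,P,\beta)$ is the number of colors used by $\varphi$ (for $n=0$ the graph is null, $\varphi$ is empty and this number is $0$). *)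

theory Defs
  imports "Graph_Theory.Graph_Theory" "HOL-Library.Infinite_Typeclass" "HOL-Library.FuncSet"
begin

text \<open>
  A finite simple graph is a \<^typ>\<open>'v pair_pre_digraph\<close> satisfying \<^locale>\<open>pair_graph\<close>: a
  finite vertex set with a symmetric, irreflexive set of arcs. The null graph is allowed.
\<close>

definition proper_coloring :: "'v pair_pre_digraph \<Rightarrow> ('v \<Rightarrow> int) \<Rightarrow> bool" where
  "proper_coloring G \<phi> \<longleftrightarrow> (\<forall>(u, v) \<in> parcs G. \<phi> u \<noteq> \<phi> v)"

definition num_colors :: "'v pair_pre_digraph \<Rightarrow> ('v \<Rightarrow> int) \<Rightarrow> nat" where
  "num_colors G \<phi> = card (\<phi> ` pverts G)"

definition chromatic_number :: "'v pair_pre_digraph \<Rightarrow> nat" where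
  "chromatic_number G = (LEAST n. \<exists>\<phi>. proper_coloring G \<phi> \<and> num_colors G \<phi> = n)"

definition clique_free :: "nat \<Rightarrow> 'v pair_pre_digraph \<Rightarrow> bool" where
  "clique_free k G \<longleftrightarrow>
    \<not> (\<exists>H :: 'v pair_pre_digraph. subgraph (with_proj H) (with_proj G) \<and> K\<^bsub>k\<^esub> (with_proj H))"

text \<open>
  The library's \<^const>\<open>tree\<close> is not suitable for symmetric digraphs: there an edge traversed back
  and forth is a \<^const>\<open>pre_digraph.cycle\<close> of length 2. The cycles of the undirected graph are
  those of length at least 3. A tree has at least one vertex by the library's notion of
  connectedness.
\<close>

definition tree_graph :: "'n pair_pre_digraph \<Rightarrow> bool" where
  "tree_graph T \<longleftrightarrow> pair_graph T \<and> Digraph_Component.connected (with_proj T) \<and>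
    \<not> (\<exists>p. pre_digraph.cycle (with_proj T) p \<and> 3 \<le> length p)"

text \<open>
  Here too \<^const>\<open>Digraph_Component.connected\<close> includes non-emptiness, and a connected
  induced subgraph of a tree is a subtree. Values of \<open>\<beta>\<close> outside the nodes of \<open>T\<close> are irrelevant.
\<close>

definition tree_decomposition ::
    "'v pair_pre_digraph \<Rightarrow> 'n pair_pre_digraph \<Rightarrow> ('n \<Rightarrow> 'v set) \<Rightarrow> bool" where
  "tree_decomposition G T \<beta> \<longleftrightarrow> tree_graph T \<and>
    (\<forall>z \<in> pverts T. \<beta> z \<subseteq> pverts G) \<and>
    (\<forall>(u, v) \<in> parcs G. \<exists>z \<in> pverts T. {u, v} \<subseteq> \<beta> z) \<and>
    (\<forall>v \<in> pverts G. Digraph_Component.connected (with_proj T \<restriction> {z \<in> pverts T. v \<in> \<beta> z}))"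

text \<open>Integer-valued, since the null graph has a decomposition of width \<open>-1\<close>.\<close>

definition decomposition_width :: "'n pair_pre_digraph \<Rightarrow> ('n \<Rightarrow> 'v set) \<Rightarrow> int" where
  "decomposition_width T \<beta> = Max ((\<lambda>z. int (card (\<beta> z)) - 1) ` pverts T)"

text \<open>Every finite tree is isomorphic to one whose nodes are natural numbers.\<close>

definition tree_width :: "'v pair_pre_digraph \<Rightarrow> int" where
  "tree_width G = (LEAST w. \<exists>(T :: nat pair_pre_digraph) \<beta>.
    tree_decomposition G T \<beta> \<and> decomposition_width T \<beta> = w)"

text \<open>The path \<open>z\<^sub>0 z\<^sub>1 \<dots> z\<^sub>n\<close>, with its order, is the list of its \<open>n + 1\<close> distinct nodes.\<close>

definition path_graph :: "'n list \<Rightarrow> 'n pair_pre_digraph" where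
  "path_graph P = \<lparr> pverts = set P, parcs = set (vwalk_arcs P) \<union> (set (vwalk_arcs P))\<inverse> \<rparr>"

definition path_decomposition :: "'v pair_pre_digraph \<Rightarrow> 'n list \<Rightarrow> ('n \<Rightarrow> 'v set) \<Rightarrow> bool" where
  "path_decomposition G P \<beta> \<longleftrightarrow> P \<noteq> [] \<and> distinct P \<and> tree_decomposition G (path_graph P) \<beta>"

definition nice_path_decomposition ::
    "'v pair_pre_digraph \<Rightarrow> 'n list \<Rightarrow> ('n \<Rightarrow> 'v set) \<Rightarrow> bool" where
  "nice_path_decomposition G P \<beta> \<longleftrightarrow> path_decomposition G P \<beta> \<and> \<beta> (P ! 0) = {} \<and>
    (\<forall>i \<in> {1..length P - 1}. card (\<beta> (P ! i) - \<beta> (P ! (i - 1))) = 1)"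

definition introduced :: "'n list \<Rightarrow> ('n \<Rightarrow> 'v set) \<Rightarrow> nat \<Rightarrow> 'v" where
  "introduced P \<beta> i = the_elem (\<beta> (P ! i) - \<beta> (P ! (i - 1)))"

definition delete_verts :: "'v pair_pre_digraph \<Rightarrow> 'v set \<Rightarrow> 'v pair_pre_digraph" where
  "delete_verts G X =
    \<lparr> pverts = pverts G - X, parcs = {(u, v) \<in> parcs G. u \<notin> X \<and> v \<notin> X} \<rparr>"

type_synonym ('v, 'n) decomposed_graph = "'v pair_pre_digraph \<times> 'n list \<times> ('n \<Rightarrow> 'v set)"

text \<open>
  The triple \<open>(G\<^sub>i, P\<^sub>i, \<beta>\<^sub>i)\<close>. As \<open>\<beta>\<^sub>i\<close> is \<^const>\<open>undefined\<close> outside \<open>P\<^sub>i\<close>, it carries no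
  information about later bags.
\<close>

definition decomposition_prefix ::
    "'v pair_pre_digraph \<Rightarrow> 'n list \<Rightarrow> ('n \<Rightarrow> 'v set) \<Rightarrow> nat \<Rightarrow> ('v, 'n) decomposed_graph" where
  "decomposition_prefix G P \<beta> i =
    (delete_verts G (introduced P \<beta> ` {i + 1..length P - 1}),
     take (i + 1) P,
     restrict \<beta> (set (take (i + 1) P)))"

text \<open>
  The coloring \<open>\<phi>(v\<^sub>i) = \<A>(G\<^sub>i, P\<^sub>i, \<beta>\<^sub>i)\<close>. In a nice path decomposition every vertex of \<open>G\<close> is
  \<open>v\<^sub>i\<close> for exactly one \<open>i\<close>, so the description is unique; other values of \<open>\<phi>\<close> are irrelevant.
\<close>

definition produced_coloring ::
    "(('v, 'n) decomposed_graph \<Rightarrow> int) \<Rightarrow>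
      'v pair_pre_digraph \<Rightarrow> 'n list \<Rightarrow> ('n \<Rightarrow> 'v set) \<Rightarrow> 'v \<Rightarrow> int" where
  "produced_coloring A G P \<beta> v =
    A (decomposition_prefix G P \<beta> (THE i. i \<in> {1..length P - 1} \<and> introduced P \<beta> i = v))"

definition online_coloring_algorithm :: "(('v, 'n) decomposed_graph \<Rightarrow> int) \<Rightarrow> bool" where
  "online_coloring_algorithm A \<longleftrightarrow>
    (\<forall>G P \<beta>. pair_graph G \<and> nice_path_decomposition G P \<beta> \<and> length P - 1 \<ge> 1 \<longrightarrow>
      proper_coloring G (produced_coloring A G P \<beta>))"

definition online_chromatic_number ::
    "(('v, 'n) decomposed_graph \<Rightarrow> int) \<Rightarrow>
      'v pair_pre_digraph \<Rightarrow> 'n list \<Rightarrow> ('n \<Rightarrow> 'v set) \<Rightarrow> nat" where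
  "online_chromatic_number A G P \<beta> = num_colors G (produced_coloring A G P \<beta>)"

text \<open>
  The graphs to be colored have their vertices in an arbitrary infinite type, so that every finite
  graph occurs up to isomorphism. The set below is finite, because \<open>\<chi>(G) \<le> t + 1\<close> for every
  graph of tree-width at most \<open>t\<close>, and for \<open>k > 0\<close> it contains \<open>0\<close>, from the null graph; hence
  \<^const>\<open>Max\<close> is a genuine maximum.
\<close>

definition max_chromatic_number :: "'v itself \<Rightarrow> nat \<Rightarrow> nat \<Rightarrow> nat" where
  "max_chromatic_number TYPE('v) t k = Max {chromatic_number G | G :: 'v pair_pre_digraph.
    pair_graph G \<and> clique_free k G \<and> tree_width G \<le> int t}"

end

theory Submission
  imports Defs "HOL-Analysis.Function_Topology"
begin

text \<open>
  A graph has tree-width at most \<open>t\<close> iff it has a perfect elimination ordering of a chordal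
  completion with cliques of size at most \<open>t + 1\<close>; sending each vertex to the latest of the other
  vertices in its clique gives a rooted tree in which every root path carries a nice path
  decomposition of width at most \<open>t\<close>.

  Given an on-line algorithm, run it along all root paths at once: the color of \<open>v\<close> depends only on
  the path to \<open>v\<close>, so this is well defined. Only the colors along a single path are bounded in
  number, so rename each color by the number of distinct colors seen before its first occurrence on
  the path; this renaming, too, only depends on the path, and it leaves \<open>c'\<close> colors in total.

  For the existence of an algorithm with \<open>c\<close> colors, consider the infinite graph whose vertices are all
  admissible inputs \<open>(H, P, \<beta>)\<close>, an input being adjacent to a prefix of it if the two vertices
  introduced last are adjacent. A coloring of this graph is an on-line algorithm. Its finite
  subgraphs are \<open>K\<^sub>k\<close>-free, since a clique is a chain of prefixes and hence appears in a single \<open>H\<close>,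
  and have tree-width at most \<open>t\<close>, the prefix order being a forest; compactness yields a
  coloring with \<open>c\<close> colors of the whole graph.
\<close>

section \<open>Rooted trees\<close>

text \<open>Elimination orderings serve as the interface to tree-width because they are used in both
  directions: from a graph to the root paths on which an on-line algorithm can be run, and from the
  prefix order on inputs to the tree-width of their graph. An algorithm may choose its colors
  differently on different branches, so although each path sees at most \<open>c'\<close> colors,
  the whole graph may show many more; the renaming stays proper because the path to a vertex
  contains its whole clique. In the other direction, the obstacle is that an answer must be fixed
  before the continuation is known and then binds all continuations at once. The graph of inputs
  records exactly these constraints, one vertex for each decision. Two mismatches remain: the
  maximum \<open>c\<close> is taken over graphs on the given vertex type, whereas the finite graphs
  of inputs have triples as vertices and must be copied into that type; and an algorithm has to be
  proper even on decompositions that are too wide and on graphs with large cliques, where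
  \<open>c\<close> colors need not suffice.\<close>

text \<open>A rank that drops at every step to the parent stands in for acyclicity and supplies the
  inductions. It need not be the depth, and \<open>p\<close> is unconstrained at
  \<open>r\<close>.\<close>

definition parent_tree :: "'n pair_pre_digraph \<Rightarrow> 'n \<Rightarrow> ('n \<Rightarrow> 'n) \<Rightarrow> ('n \<Rightarrow> nat) \<Rightarrow> bool" where
  "parent_tree T r p rk \<longleftrightarrow> finite (pverts T) \<and> r \<in> pverts T \<and>
    (\<forall>x \<in> pverts T - {r}. p x \<in> pverts T \<and> rk (p x) < rk x) \<and>
    parcs T = (\<lambda>x. (x, p x)) ` (pverts T - {r}) \<union> (\<lambda>x. (p x, x)) ` (pverts T - {r})"

lemma pair_graphI:
  assumes "finite (pverts G)" "parcs G \<subseteq> pverts G \<times> pverts G"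
    and "\<And>u v. (u, v) \<in> parcs G \<Longrightarrow> (v, u) \<in> parcs G"
    and "\<And>u. (u, u) \<notin> parcs G"
  shows "pair_graph G"
proof -
  have "finite (parcs G)" using assms(1,2) finite_subset by blast
  then show ?thesis
    using assms by unfold_locales (auto simp: symmetric_def sym_def)
qed

lemma pair_graphD:
  assumes "pair_graph G"
  shows "finite (pverts G)" "parcs G \<subseteq> pverts G \<times> pverts G"
    and "\<And>u v. (u, v) \<in> parcs G \<Longrightarrow> (v, u) \<in> parcs G"
    and "\<And>u. (u, u) \<notin> parcs G"
proof -
  interpret pair_graph G by fact
  show "finite (pverts G)" "parcs G \<subseteq> pverts G \<times> pverts G"
    "\<And>u v. (u, v) \<in> parcs G \<Longrightarrow> (v, u) \<in> parcs G" "\<And>u. (u, u) \<notin> parcs G"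
    by (auto dest: in_arcsD1 in_arcsD2 arcs_symmetric no_loops')
qed

lemma reachable_iff_rtrancl:
  assumes "pair_wf_digraph G"
  shows "u \<rightarrow>\<^sup>*\<^bsub>with_proj G\<^esub> v \<longleftrightarrow> u \<in> pverts G \<and> (u, v) \<in> (parcs G)\<^sup>*"
proof -
  interpret pair_wf_digraph G by fact
  show ?thesis unfolding reachable_def
    by (auto dest: in_rtrancl_on_in_F rtrancl_on_rtranclI wellformed'
      intro!: rtrancl_consistent_rtrancl_on elim: rtranclE)
qed

text \<open>Connectedness is defined through \<open>mk_symmetric\<close>, which adds nothing to arcs
  that are already symmetric. What remains is a statement about a reflexive transitive closure, open
  to plain induction.\<close>

lemma connected_induce_iff:
  assumes "pair_graph T" "S \<subseteq> pverts T"
  shows "Digraph_Component.connected (with_proj T \<restriction> S) \<longleftrightarrow>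
    S \<noteq> {} \<and> (\<forall>u \<in> S. \<forall>v \<in> S. (u, v) \<in> (Restr (parcs T) S)\<^sup>*)"
proof -
  have eq: "parcs (mk_symmetric (with_proj T \<restriction> S)) = Restr (parcs T) S"
    using pair_graphD(3)[OF assms(1)] by (force simp: parcs_mk_symmetric)
  have "pair_wf_digraph (mk_symmetric (with_proj T \<restriction> S))"
    by (rule pair_wf_digraph.intro) (auto simp: eq)
  then show ?thesis
    by (simp add: connected_def strongly_connected_def reachable_iff_rtrancl eq)
qed

lemma connected_iff:
  assumes "pair_graph T"
  shows "Digraph_Component.connected (with_proj T) \<longleftrightarrow>
    pverts T \<noteq> {} \<and> (\<forall>u \<in> pverts T. \<forall>v \<in> pverts T. (u, v) \<in> (parcs T)\<^sup>*)"
proof -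
  have "{e \<in> parcs T. fst e \<in> pverts T \<and> snd e \<in> pverts T} = parcs T"
    using pair_graphD(2)[OF assms] by auto
  then have "mk_symmetric (with_proj T) = mk_symmetric (with_proj T \<restriction> pverts T)"
    by (simp add: mk_symmetric_def)
  then have "Digraph_Component.connected (with_proj T) = Digraph_Component.connected (with_proj T \<restriction> pverts T)"
    by (simp add: connected_def)
  moreover have "Restr (parcs T) (pverts T) = parcs T"
    using pair_graphD(2)[OF assms] by auto
  ultimately show ?thesis using connected_induce_iff[OF assms order_refl] by simp
qed

lemma parent_treeD:
  assumes "parent_tree T r p rk"
  shows "finite (pverts T)" "r \<in> pverts T"
    and "\<And>x. x \<in> pverts T \<Longrightarrow> x \<noteq> r \<Longrightarrow> p x \<in> pverts T"
    and "\<And>x. x \<in> pverts T \<Longrightarrow> x \<noteq> r \<Longrightarrow> rk (p x) < rk x"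
    and "(a, b) \<in> parcs T \<longleftrightarrow>
      a \<in> pverts T \<and> a \<noteq> r \<and> b = p a \<or> b \<in> pverts T \<and> b \<noteq> r \<and> a = p b"
proof -
  show "finite (pverts T)" "r \<in> pverts T"
    "\<And>x. x \<in> pverts T \<Longrightarrow> x \<noteq> r \<Longrightarrow> p x \<in> pverts T"
    "\<And>x. x \<in> pverts T \<Longrightarrow> x \<noteq> r \<Longrightarrow> rk (p x) < rk x"
    using assms by (simp_all add: parent_tree_def)
  have "parcs T = (\<lambda>x. (x, p x)) ` (pverts T - {r}) \<union> (\<lambda>x. (p x, x)) ` (pverts T - {r})"
    using assms by (simp add: parent_tree_def)
  then show "(a, b) \<in> parcs T \<longleftrightarrow>
      a \<in> pverts T \<and> a \<noteq> r \<and> b = p a \<or> b \<in> pverts T \<and> b \<noteq> r \<and> a = p b"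
    by (simp only:) auto
qed

lemma parent_tree_pair_graph:
  assumes "parent_tree T r p rk"
  shows "pair_graph T"
proof (rule pair_graphI)
  show "finite (pverts T)" "parcs T \<subseteq> pverts T \<times> pverts T"
    "\<And>u v. (u, v) \<in> parcs T \<Longrightarrow> (v, u) \<in> parcs T"
    using assms by (auto simp: parent_tree_def)
  show "(u, u) \<notin> parcs T" for u
  proof
    assume "(u, u) \<in> parcs T"
    then have "u \<in> pverts T" "u \<noteq> r" "p u = u" using parent_treeD(5)[OF assms] by metis+
    then show False using parent_treeD(4)[OF assms] by (metis less_irrefl)
  qed
qed

text \<open>Every element of \<open>S\<close> climbs to \<open>s\<close> inside \<open>S\<close>, by
  induction on the rank; since arcs are symmetric, any two elements are joined through
  \<open>s\<close>.\<close>

lemma parent_tree_connected_induce: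
  assumes T: "parent_tree T r p rk" and S: "S \<subseteq> pverts T" "s \<in> S"
    and up: "\<And>x. x \<in> S \<Longrightarrow> x \<noteq> s \<Longrightarrow> x \<noteq> r \<and> p x \<in> S"
  shows "Digraph_Component.connected (with_proj T \<restriction> S)"
proof -
  let ?R = "Restr (parcs T) S"
  have *: "(x, s) \<in> ?R\<^sup>*" if "x \<in> S" for x
    using that
  proof (induction "rk x" arbitrary: x rule: less_induct)
    case less
    show ?case
    proof (cases "x = s")
      case False
      then have "x \<in> pverts T - {r}" "p x \<in> S" using up less.prems S by auto
      moreover from this have "(x, p x) \<in> ?R" "rk (p x) < rk x"
        using T less.prems by (auto simp: parent_tree_def)
      ultimately show ?thesis using less.hyps by (meson converse_rtrancl_into_rtrancl)
    qed simp
  qed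
  have pg: "pair_graph T" using parent_tree_pair_graph[OF T] .
  have "sym ?R" using pair_graphD(3)[OF pg] by (auto simp: sym_def)
  then have "sym (?R\<^sup>*)" by (rule sym_rtrancl)
  then have "(u, v) \<in> ?R\<^sup>*" if "u \<in> S" "v \<in> S" for u v
    using *[OF that(1)] *[OF that(2)] by (meson rtrancl_trans symD)
  then show ?thesis using connected_induce_iff[OF pg S(1)] S(2) by blast
qed

lemma pcas_nth:
  assumes "pcas u q v" "Suc i < length q"
  shows "snd (q ! i) = fst (q ! Suc i)"
  using assms
proof (induction q arbitrary: u i)
  case (Cons e es)
  then show ?case by (cases i; cases es) auto
qed simp

lemma pcas_last: "pcas u q v \<Longrightarrow> q \<noteq> [] \<Longrightarrow> snd (last q) = v"
  by (induction q arbitrary: u) auto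

lemma pcas_hd: "pcas u q v \<Longrightarrow> q \<noteq> [] \<Longrightarrow> fst (hd q) = u"
  by (cases q) auto

text \<open>At a node of maximal rank on the cycle, both neighbours on the cycle must be its parent;
  with length at least 3 they are distinct nodes.\<close>

lemma parent_tree_no_cycle:
  assumes T: "parent_tree T r p rk" and cyc: "pre_digraph.cycle (with_proj T) q" and len: "3 \<le> length q"
  shows False
proof -
  let ?n = "length q"
  from cyc obtain u where q: "set q \<subseteq> parcs T" "pcas u q u" "distinct (tl (pawalk_verts u q))"
    by (auto simp: pre_digraph.cycle_def pre_digraph.awalk_def cas_with_proj_eq awalk_verts_with_proj_eq)
  have ne: "q \<noteq> []" using len by auto
  have verts: "pawalk_verts u q = fst (hd q) # map snd q"
    using pre_digraph.awalk_verts_conv'[of "with_proj T" u q u] q(2) ne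
    by (simp add: cas_with_proj_eq awalk_verts_with_proj_eq)
  \<comment> \<open>Indexing modulo the length gives every node a successor and a predecessor, also
    across the end of the list.\<close>
  define y where "y i = snd (q ! (i mod ?n))" for i
  have y_inj: "y i \<noteq> y j" if "i mod ?n \<noteq> j mod ?n" for i j
  proof -
    have "distinct (map snd q)" using q(3) verts by simp
    moreover have "i mod ?n < ?n" "j mod ?n < ?n" using ne by simp_all
    ultimately show ?thesis using that unfolding y_def by (metis length_map nth_eq_iff_index_eq nth_map)
  qed
  have y_arc: "(y i, y (Suc i)) \<in> parcs T" for i
  proof -
    have "fst (q ! (Suc i mod ?n)) = y i"
    proof (cases "Suc (i mod ?n) = ?n")
      case True
      then have "Suc i mod ?n = 0" using ne by (simp add: mod_Suc)
      moreover have "i mod ?n = ?n - 1" using True by simp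
      then have "y i = u" using pcas_last[OF q(2) ne] ne by (simp add: y_def last_conv_nth)
      ultimately show ?thesis using pcas_hd[OF q(2) ne] ne by (simp add: hd_conv_nth)
    next
      case False
      then have "Suc i mod ?n = Suc (i mod ?n)" by (simp add: mod_Suc)
      moreover have "Suc (i mod ?n) < ?n" using False ne
        by (metis Suc_lessI length_greater_0_conv mod_less_divisor)
      ultimately show ?thesis using pcas_nth[OF q(2)] by (simp add: y_def)
    qed
    moreover have "q ! (Suc i mod ?n) \<in> parcs T"
      using q(1) ne by (meson length_greater_0_conv mod_less_divisor nth_mem subsetD)
    ultimately show ?thesis unfolding y_def by (metis prod.collapse)
  qed
  have "finite (rk ` y ` {..<?n})" "rk ` y ` {..<?n} \<noteq> {}" using ne by auto
  from Max_in[OF this] obtain m where m: "m < ?n" "rk (y m) = Max (rk ` y ` {..<?n})" by auto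
  have max: "rk (y i) \<le> rk (y m)" for i
  proof -
    have "y i = y (i mod ?n)" "i mod ?n < ?n" using ne by (auto simp: y_def)
    then show ?thesis unfolding m(2) by (intro Max_ge) auto
  qed
  have adj: "b = p a" if "(a, b) \<in> parcs T \<or> (b, a) \<in> parcs T" "rk b \<le> rk a" for a b
    using that parent_treeD(4,5)[OF T] by (metis not_less)
  \<comment> \<open>The position before \<open>m\<close> modulo \<open>?n\<close>, written so that
    truncated subtraction does no harm at \<open>m = 0\<close>.\<close>
  let ?l = "m + ?n - 1"
  have "Suc ?l = m + ?n" using len by simp
  then have "y (Suc ?l) = y m" by (simp add: y_def)
  then have "y ?l = p (y m)" using y_arc[of ?l] adj max by metis
  moreover have "y (Suc m) = p (y m)" using y_arc[of m] adj max by metis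
  \<comment> \<open>The two positions differ by \<open>?n - 2\<close>, which is positive and less
    than \<open>?n\<close>.\<close>
  moreover have "?l mod ?n \<noteq> Suc m mod ?n"
  proof
    assume "?l mod ?n = Suc m mod ?n"
    then have "?n dvd (?l - Suc m)" using len
      by (metis Suc_eq_plus1 add.commute mod_eq_dvd_iff_nat add_diff_assoc2 diff_is_0_eq dvd_0_right le_cases)
    moreover have "?l - Suc m = ?n - 2" using len by simp
    ultimately show False using len by (simp add: nat_dvd_not_less)
  qed
  ultimately show False using y_inj by metis
qed

lemma parent_tree_tree_graph:
  assumes "parent_tree T r p rk"
  shows "tree_graph T"
proof -
  have pg: "pair_graph T" using parent_tree_pair_graph[OF assms] .
  have "Digraph_Component.connected (with_proj T \<restriction> pverts T)"
    by (rule parent_tree_connected_induce[OF assms order_refl, of r])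
      (use assms in \<open>auto simp: parent_tree_def\<close>)
  moreover have "Restr (parcs T) (pverts T) = parcs T"
    using pair_graphD(2)[OF pg] by auto
  ultimately have "Digraph_Component.connected (with_proj T)"
    using connected_iff[OF pg] connected_induce_iff[OF pg order_refl] by simp
  then show ?thesis
    using pg parent_tree_no_cycle[OF assms] by (auto simp: tree_graph_def)
qed

text \<open>Converse of \<open>parent_tree_connected_induce\<close>: an element of least rank is the
  top. If another element \<open>x\<close> had no parent in \<open>S\<close>, no walk in
  \<open>S\<close> from \<open>x\<close> could leave the nodes below \<open>x\<close>, so the
  element of least rank would lie below \<open>x\<close> and have a larger rank.\<close>

lemma parent_tree_connected_top:
  assumes T: "parent_tree T r p rk" and S: "S \<subseteq> pverts T"
    and conn: "Digraph_Component.connected (with_proj T \<restriction> S)"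
  shows "\<exists>s \<in> S. \<forall>x \<in> S. x \<noteq> s \<longrightarrow> x \<noteq> r \<and> p x \<in> S"
proof -
  let ?R = "Restr (parcs T) S"
  have pg: "pair_graph T" using parent_tree_pair_graph[OF T] .
  have ne: "S \<noteq> {}" and reach: "\<And>u v. u \<in> S \<Longrightarrow> v \<in> S \<Longrightarrow> (u, v) \<in> ?R\<^sup>*"
    using conn connected_induce_iff[OF pg S] by auto
  obtain s where s: "s \<in> S" "\<And>x. x \<in> S \<Longrightarrow> rk s \<le> rk x"
    using ex_has_least_nat[of "\<lambda>x. x \<in> S" _ rk] ne by blast
  have "x \<noteq> r \<and> p x \<in> S" if x: "x \<in> S" "x \<noteq> s" for x
  proof -
    let ?Q = "(\<lambda>x. (x, p x)) ` (pverts T - {r})"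
    have rk: "rk b < rk a \<or> b = a" if "(a, b) \<in> ?Q\<^sup>*" for a b
      using that
    proof induction
      case (step b c)
      then have "c = p b" "rk c < rk b" using parent_treeD(4)[OF T] by auto
      with step.IH show ?case by auto
    qed simp
    have "(s, x) \<notin> ?Q\<^sup>*" using rk s(2)[OF x(1)] x(2) by (metis leD)
    have "\<exists>b. (x, b) \<in> ?Q \<and> b \<in> S"
    proof (rule ccontr)
      assume no: "\<not> ?thesis"
      have "(y, x) \<in> ?Q\<^sup>*" if "(x, y) \<in> ?R\<^sup>*" for y
        using that
      proof induction
        case (step a b)
        then consider "(a, b) \<in> ?Q" | "(b, a) \<in> ?Q" using parent_treeD(5)[OF T, of a b] by auto
        then show ?case
        proof cases
          case 1
          \<comment> \<open>Parents are unique, so a climb of positive length from \<open>a\<close>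
            to \<open>x\<close> begins with the step to \<open>b\<close>.\<close>
          then have "a \<noteq> x" using no step.hyps by blast
          with step.IH obtain b' where b': "(a, b') \<in> ?Q" "(b', x) \<in> ?Q\<^sup>*"
            by (auto elim: converse_rtranclE)
          have "b' = b" using 1 b'(1) by force
          then show ?thesis using b'(2) by simp
        next
          case 2
          then show ?thesis using step.IH by (meson converse_rtrancl_into_rtrancl)
        qed
      qed simp
      then show False using reach x s(1) \<open>(s, x) \<notin> ?Q\<^sup>*\<close> by blast
    qed
    then show ?thesis by auto
  qed
  then show ?thesis using s(1) by blast
qed

text \<open>Two neighbours of \<open>b\<close> in \<open>S\<close> would be joined by a path inside
  \<open>S\<close>; closed up through \<open>b\<close>, it would be a cycle of length at least
  3.\<close>

lemma tree_graph_unique_neighbour: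
  assumes T: "tree_graph T" and S: "S \<subseteq> pverts T" "b \<notin> S"
    and conn: "Digraph_Component.connected (with_proj T \<restriction> S)"
    and a: "a \<in> S" "(a, b) \<in> parcs T" and a': "a' \<in> S" "(a', b) \<in> parcs T"
  shows "a = a'"
proof (rule ccontr)
  assume ne: "a \<noteq> a'"
  have pg: "pair_graph T" using T by (simp add: tree_graph_def)
  interpret pair_graph T by fact
  interpret H: wf_digraph "with_proj T \<restriction> S" by (rule wellformed_induce_subgraph)
  have cas: "pre_digraph.cas (with_proj T \<restriction> S) = pcas"
    using compatible_cas[OF compatible_induce_subgraph] cas_with_proj_eq by metis
  have averts: "pre_digraph.awalk_verts (with_proj T \<restriction> S) = pawalk_verts"
    using compatible_awalk_verts[OF compatible_induce_subgraph] awalk_verts_with_proj_eq by metis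
  have "arcs_ends (with_proj T \<restriction> S) = Restr (parcs T) S"
    by (auto simp: arcs_ends_conv)
  moreover have "(a, a') \<in> rtrancl_on S (Restr (parcs T) S)"
    using conn connected_induce_iff[OF pg S(1)] a a'
    by (intro rtrancl_consistent_rtrancl_on) auto
  ultimately have "a \<rightarrow>\<^sup>*\<^bsub>with_proj T \<restriction> S\<^esub> a'" by (simp add: reachable_def)
  then obtain q where q: "H.apath a q a'" using H.reachable_apath by blast
  then have q1: "set q \<subseteq> parcs T" "pcas a q a'" "distinct (pawalk_verts a q)"
    by (auto simp: H.apath_def H.awalk_def cas averts)
  have verts_q: "set (pawalk_verts a q) \<subseteq> S"
    using q unfolding H.apath_def H.awalk_conv by (simp add: averts)
  have "q \<noteq> []" using q1(2) ne by auto
  let ?c = "(b, a) # q @ [(a', b)]"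
  have "awalk b ?c b"
    using q1 a a' pair_graphD(2,3)[OF pg] by (auto simp: awalk_def cas_append_iff)
  moreover have "pawalk_verts a (q @ [(a', b)]) = pawalk_verts a q @ [b]"
    using q1(2) by (induction q arbitrary: a) auto
  then have "distinct (tl (awalk_verts b ?c))"
    using q1(3) verts_q S(2) by auto
  ultimately have "cycle ?c" unfolding cycle_def by auto
  moreover have "3 \<le> length ?c" using \<open>q \<noteq> []\<close> by (cases q) auto
  ultimately show False using T unfolding tree_graph_def by blast
qed

text \<open>A connected set of nodes is grown by one node \<open>b\<close> at a time. The only
  neighbour of \<open>b\<close> in the set becomes its parent;
  \<open>tree_graph_unique_neighbour\<close> is where acyclicity enters.\<close>

lemma tree_graph_parent_tree:
  assumes T: "tree_graph T"
  obtains r p rk where "parent_tree T r p rk"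
proof -
  have pg: "pair_graph T" and conn: "Digraph_Component.connected (with_proj T)"
    using T by (auto simp: tree_graph_def)
  note fin = pair_graphD(1)[OF pg]
  have ne: "pverts T \<noteq> {}" and reach: "\<And>u v. u \<in> pverts T \<Longrightarrow> v \<in> pverts T \<Longrightarrow> (u, v) \<in> (parcs T)\<^sup>*"
    using conn connected_iff[OF pg] by auto
  let ?sub = "\<lambda>S. \<lparr>pverts = S, parcs = Restr (parcs T) S\<rparr>"
  have "\<exists>S r p rk. S \<subseteq> pverts T \<and> card S = Suc n \<and> parent_tree (?sub S) r p rk"
    if "n < card (pverts T)" for n
    using that
  proof (induction n)
    case 0
    obtain r where "r \<in> pverts T" using ne by auto
    then show ?case using pair_graphD(4)[OF pg, of r]
      by (intro exI[of _ "{r}"] exI[of _ r]) (auto simp: parent_tree_def)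
  next
    case (Suc n)
    then obtain S r p rk where S: "S \<subseteq> pverts T" "card S = Suc n"
      and pt: "parent_tree (?sub S) r p rk" by auto
    have finS: "finite S" using S(1) fin finite_subset by blast
    have "S \<noteq> pverts T" using Suc.prems S(2) by auto
    then obtain v where v: "v \<in> pverts T" "v \<notin> S" using S(1) by auto
    have "r \<in> S" using pt by (auto simp: parent_tree_def)
    have "(r, v) \<in> (parcs T)\<^sup>*" using reach \<open>r \<in> S\<close> S(1) v by blast
    then have "\<exists>a b. a \<in> S \<and> b \<notin> S \<and> (a, b) \<in> parcs T" using v(2) \<open>r \<in> S\<close>
      by (induction rule: rtrancl_induct) auto
    then obtain a b where ab: "a \<in> S" "b \<notin> S" "(a, b) \<in> parcs T" by blast
    have b: "b \<in> pverts T" using ab(3) pair_graphD(2)[OF pg] by auto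
    have "Digraph_Component.connected (with_proj (?sub S) \<restriction> S)"
      by (rule parent_tree_connected_induce[OF pt, of _ r])
        (use pt in \<open>auto simp: parent_tree_def\<close>)
    then have "Digraph_Component.connected (with_proj T \<restriction> S)"
      using connected_induce_iff[OF parent_tree_pair_graph[OF pt], of S]
        connected_induce_iff[OF pg S(1)] by (simp add: Int_assoc)
    then have uniq: "a' = a" if "a' \<in> S" "(a', b) \<in> parcs T" for a'
      using tree_graph_unique_neighbour[OF T S(1) ab(2)] ab that by blast
    let ?S = "insert b S"
    define p' where "p' = p(b := a)"
    define rk' where "rk' = rk(b := Suc (rk a))"
    have subarcs: "Restr (parcs T) S = (\<lambda>x. (x, p x)) ` (S - {r}) \<union> (\<lambda>x. (p x, x)) ` (S - {r})"
      and par: "\<And>x. x \<in> S - {r} \<Longrightarrow> p x \<in> S \<and> rk (p x) < rk x"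
      using pt by (auto simp: parent_tree_def)
    have img: "(\<lambda>x. (x, p' x)) ` (?S - {r}) = insert (b, a) ((\<lambda>x. (x, p x)) ` (S - {r}))"
      "(\<lambda>x. (p' x, x)) ` (?S - {r}) = insert (a, b) ((\<lambda>x. (p x, x)) ` (S - {r}))"
      using ab(2) \<open>r \<in> S\<close> by (auto simp: p'_def image_iff)
    have "Restr (parcs T) ?S = insert (a, b) (insert (b, a) (Restr (parcs T) S))"
      using uniq ab pair_graphD(3,4)[OF pg] by blast
    also have "\<dots> = (\<lambda>x. (x, p' x)) ` (?S - {r}) \<union> (\<lambda>x. (p' x, x)) ` (?S - {r})"
      unfolding subarcs img by blast
    finally have "parent_tree (?sub ?S) r p' rk'"
      using \<open>r \<in> S\<close> finS par ab by (auto simp: parent_tree_def p'_def rk'_def)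
    moreover have "card ?S = Suc (Suc n)" using S(2) ab(2) finS by simp
    ultimately show ?case using S(1) b by (intro exI[of _ ?S]) blast
  qed
  from this[of "card (pverts T) - 1"]
  obtain S r p rk where S: "S \<subseteq> pverts T" "card S = card (pverts T)"
    and pt: "parent_tree (?sub S) r p rk"
    using ne fin by (auto simp: card_gt_0_iff)
  have "S = pverts T" using S fin by (simp add: card_subset_eq)
  moreover have "Restr (parcs T) (pverts T) = parcs T"
    using pair_graphD(2)[OF pg] by auto
  ultimately have "parent_tree T r p rk" using pt by (simp add: parent_tree_def)
  then show ?thesis using that by blast
qed

section \<open>Tree-width and elimination orderings\<close>

text \<open>Elimination orderings need injective ranks, while the measures at hand (the rank of a
  topmost node, the length of an input) have ties. \<open>f\<close> becomes the leading digit in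
  base \<open>card V\<close>, and a numbering of \<open>V\<close> the last one.\<close>

lemma finite_tie_breaking:
  fixes f :: "'a \<Rightarrow> nat"
  assumes "finite V"
  obtains rk :: "'a \<Rightarrow> nat" where "inj_on rk V"
    and "\<And>v w. v \<in> V \<Longrightarrow> w \<in> V \<Longrightarrow> f v < f w \<Longrightarrow> rk v < rk w"
proof -
  obtain e where e: "bij_betw e V {0..<card V}" using ex_bij_betw_finite_nat[OF assms] by blast
  have lt: "e v < card V" if "v \<in> V" for v using bij_betwE[OF e] that by auto
  define rk where "rk v = f v * card V + e v" for v
  have mono: "rk v < rk w" if "v \<in> V" "w \<in> V" "f v < f w" for v w
  proof -
    have "f v * card V + e v < Suc (f v) * card V" using lt[OF that(1)] by simp
    also have "\<dots> \<le> f w * card V" using that(3) by (intro mult_le_mono1) simp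
    finally show ?thesis by (simp add: rk_def)
  qed
  have "inj_on rk V"
  proof (rule inj_onI)
    fix v w assume vw: "v \<in> V" "w \<in> V" "rk v = rk w"
    then have "f v = f w" using mono by (metis less_irrefl nat_neq_iff)
    then have "e v = e w" using vw(3) by (simp add: rk_def)
    then show "v = w" using e vw(1,2) by (meson bij_betw_imp_inj_on inj_onD)
  qed
  then show ?thesis using mono that by blast
qed

text \<open>\<open>tree_width\<close> is a \<open>LEAST\<close> over the integers, which are not
  well-ordered; subtracting the lower bound moves the minimum to the naturals.\<close>

lemma Least_int_bounded:
  fixes P :: "int \<Rightarrow> bool"
  assumes "P w" and bound: "\<And>w. P w \<Longrightarrow> b \<le> w"
  shows "P (LEAST w. P w)" and "(LEAST w. P w) \<le> w"
proof -
  let ?Q = "\<lambda>n. P (int n + b)"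
  have Q: "?Q (nat (x - b))" if "P x" for x using that bound[OF that] by simp
  have min: "P (int (LEAST n. ?Q n) + b)" by (rule LeastI) (rule Q[OF assms(1)])
  have eq: "(LEAST w. P w) = int (LEAST n. ?Q n) + b"
  proof (rule Least_equality)
    fix y assume "P y"
    then have "(LEAST n. ?Q n) \<le> nat (y - b)" by (intro Least_le Q)
    then show "int (LEAST n. ?Q n) + b \<le> y" using bound[OF \<open>P y\<close>] by linarith
  qed (rule min)
  show "P (LEAST w. P w)" using min eq by simp
  have "(LEAST n. ?Q n) \<le> nat (w - b)" by (intro Least_le Q assms)
  then show "(LEAST w. P w) \<le> w" using eq bound[OF assms(1)] by linarith
qed

lemma decomposition_width_le_iff:
  assumes "finite (pverts T)" "pverts T \<noteq> {}"
  shows "decomposition_width T \<beta> \<le> int t \<longleftrightarrow> (\<forall>z \<in> pverts T. card (\<beta> z) \<le> Suc t)"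
  using assms by (auto simp: decomposition_width_def)

lemma decomposition_width_ge:
  assumes "finite (pverts T)" "pverts T \<noteq> {}"
  shows "- 1 \<le> decomposition_width T \<beta>"
  using assms by (auto simp: decomposition_width_def Max_ge_iff)

lemma tree_graph_verts:
  assumes "tree_graph T"
  shows "finite (pverts T)" "pverts T \<noteq> {}"
  using assms pair_graphD(1) connected_iff by (auto simp: tree_graph_def)

text \<open>
  \<open>B v\<close> consists of \<open>v\<close> and its earlier neighbours in a chordal completion; it is also the bag of the
  node that introduces \<open>v\<close>.
\<close>

definition peo :: "'v pair_pre_digraph \<Rightarrow> ('v \<Rightarrow> nat) \<Rightarrow> ('v \<Rightarrow> 'v set) \<Rightarrow> nat \<Rightarrow> bool" where
  "peo G rk B t \<longleftrightarrow> inj_on rk (pverts G) \<and>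
    (\<forall>v \<in> pverts G. v \<in> B v \<and> B v \<subseteq> pverts G \<and> card (B v) \<le> Suc t \<and>
      (\<forall>w \<in> B v. rk w \<le> rk v) \<and> (\<forall>w \<in> B v. \<forall>u \<in> B v. rk w \<le> rk u \<longrightarrow> w \<in> B u)) \<and>
    (\<forall>(u, v) \<in> parcs G. u \<in> B v \<or> v \<in> B u)"

lemma peoD:
  assumes "peo G rk B t"
  shows "inj_on rk (pverts G)"
    and "v \<in> pverts G \<Longrightarrow> v \<in> B v" "v \<in> pverts G \<Longrightarrow> B v \<subseteq> pverts G"
    and "v \<in> pverts G \<Longrightarrow> card (B v) \<le> Suc t"
    and "v \<in> pverts G \<Longrightarrow> w \<in> B v \<Longrightarrow> rk w \<le> rk v"
    and "v \<in> pverts G \<Longrightarrow> w \<in> B v \<Longrightarrow> u \<in> B v \<Longrightarrow> rk w \<le> rk u \<Longrightarrow> w \<in> B u"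
    and "(u, v) \<in> parcs G \<Longrightarrow> u \<in> B v \<or> v \<in> B u"
  using assms unfolding peo_def by blast+

definition peo_parent :: "('v \<Rightarrow> nat) \<Rightarrow> ('v \<Rightarrow> 'v set) \<Rightarrow> 'v \<Rightarrow> 'v" where
  "peo_parent rk B v =
    (SOME u. u \<in> B v - {v} \<and> (\<forall>w \<in> B v - {v}. rk w \<le> rk u))"

text \<open>The last inclusion is the reason for taking the latest member: no other member comes
  after it, so the elimination property puts them all into its clique. Along a root path each bag
  therefore adds only its own vertex to the preceding one.\<close>

lemma peo_parent:
  assumes G: "finite (pverts G)" "peo G rk B t" and v: "v \<in> pverts G" "B v \<noteq> {v}"
  shows "peo_parent rk B v \<in> pverts G" "peo_parent rk B v \<in> B v"
    and "rk (peo_parent rk B v) < rk v" "B v - {v} \<subseteq> B (peo_parent rk B v)"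
proof -
  let ?u = "peo_parent rk B v"
  note p = peoD[OF G(2)]
  have "finite (B v - {v})" using p(3)[OF v(1)] G(1) finite_subset by blast
  moreover have "B v - {v} \<noteq> {}" using p(2)[OF v(1)] v(2) by auto
  ultimately have fin: "finite (rk ` (B v - {v}))" "rk ` (B v - {v}) \<noteq> {}" by auto
  from Max_in[OF this] obtain u where "u \<in> B v - {v}" "rk u = Max (rk ` (B v - {v}))" by (metis imageE)
  moreover from this have "\<forall>w \<in> B v - {v}. rk w \<le> rk u" using Max_ge[OF fin(1)] by auto
  ultimately have "\<exists>u. u \<in> B v - {v} \<and> (\<forall>w \<in> B v - {v}. rk w \<le> rk u)" by blast
  from someI_ex[OF this] have u: "?u \<in> B v - {v}" "\<And>w. w \<in> B v - {v} \<Longrightarrow> rk w \<le> rk ?u"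
    unfolding peo_parent_def by blast+
  show "?u \<in> pverts G" "?u \<in> B v" using u(1) p(3)[OF v(1)] by auto
  then have "rk ?u \<noteq> rk v" using u(1) p(1) v(1) by (metis Diff_iff inj_onD singletonI)
  then show "rk ?u < rk v" using p(5)[OF v(1), of ?u] u(1) by auto
  show "B v - {v} \<subseteq> B ?u" using p(6)[OF v(1)] u by auto
qed

text \<open>Node \<open>Suc (rk v)\<close> carries the clique of \<open>v\<close>. Node 0 is an
  extra root with empty bag, which joins the components and gives the null graph its tree.\<close>

lemma peo_tree_decomposition:
  assumes G: "pair_graph G" and peo: "peo G rk B t"
  obtains T :: "nat pair_pre_digraph" and \<beta> where "tree_decomposition G T \<beta>"
    and "decomposition_width T \<beta> \<le> int t"
proof -
  let ?V = "pverts G"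
  note p = peoD[OF peo]
  have fin: "finite ?V" using pair_graphD(1)[OF G] .
  define vx where "vx n = inv_into ?V rk (n - 1)" for n
  have vx: "vx (Suc (rk v)) = v" if "v \<in> ?V" for v
    using that p(1) by (simp add: vx_def)
  define N where "N = insert 0 ((\<lambda>v. Suc (rk v)) ` ?V)"
  define par where "par n = (if B (vx n) = {vx n} then 0 else Suc (rk (peo_parent rk B (vx n))))" for n
  define T where "T = \<lparr>pverts = N, parcs = (\<lambda>x. (x, par x)) ` (N - {0}) \<union> (\<lambda>x. (par x, x)) ` (N - {0})\<rparr>"
  define \<beta> where "\<beta> n = (if n = 0 then {} else B (vx n))" for n
  note u = peo_parent[OF fin peo]
  have "par x \<in> N \<and> par x < x" if x: "x \<in> N - {0}" for x
  proof -
    obtain v where v: "v \<in> ?V" "x = Suc (rk v)" using x by (auto simp: N_def)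
    show ?thesis
      using u(1,3)[OF v(1)] v by (cases "B v = {v}") (auto simp: N_def par_def vx)
  qed
  then have pt: "parent_tree T 0 par id"
    using fin by (simp add: parent_tree_def T_def N_def)
  have tg: "tree_graph T" using parent_tree_tree_graph[OF pt] .
  \<comment> \<open>The topmost occurrence of \<open>v\<close> is at its own node: any other clique
    containing \<open>v\<close> passes it on to the clique of the parent.\<close>
  have "Digraph_Component.connected (with_proj T \<restriction> {z \<in> pverts T. v \<in> \<beta> z})"
    if v: "v \<in> ?V" for v
  proof (rule parent_tree_connected_induce[OF pt])
    show "Suc (rk v) \<in> {z \<in> pverts T. v \<in> \<beta> z}"
      using v p(2) by (simp add: T_def N_def \<beta>_def vx)
    fix z assume z: "z \<in> {z \<in> pverts T. v \<in> \<beta> z}" "z \<noteq> Suc (rk v)"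
    have "z \<in> N" "z \<noteq> 0" "v \<in> B (vx z)" using z(1) by (auto simp: T_def \<beta>_def split: if_splits)
    then obtain x where "x \<in> ?V" "z = Suc (rk x)" unfolding N_def by blast
    with \<open>v \<in> B (vx z)\<close> have x: "x \<in> ?V" "z = Suc (rk x)" "v \<in> B x" by (simp_all add: vx)
    have "x \<noteq> v" using z(2) x(2) by auto
    note x = x this
    then have "B x \<noteq> {x}" by auto
    then show "z \<noteq> 0 \<and> par z \<in> {z \<in> pverts T. v \<in> \<beta> z}"
      using u[of x] x by (auto simp: T_def N_def \<beta>_def par_def vx)
  qed auto
  moreover have "\<exists>z \<in> pverts T. {a, b} \<subseteq> \<beta> z" if "(a, b) \<in> parcs G" for a b
  proof -
    have "a \<in> ?V" "b \<in> ?V" using that pair_graphD(2)[OF G] by auto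
    moreover from this have "a \<in> B b \<and> b \<in> B b \<or> a \<in> B a \<and> b \<in> B a"
      using p(2,7) that by blast
    ultimately show ?thesis by (auto simp: T_def N_def \<beta>_def vx)
  qed
  moreover have "\<beta> z \<subseteq> ?V" if "z \<in> pverts T" for z
    using that p(3) by (auto simp: T_def N_def \<beta>_def vx subset_iff)
  ultimately have "tree_decomposition G T \<beta>"
    using tg by (auto simp: tree_decomposition_def)
  moreover have "card (\<beta> z) \<le> Suc t" if "z \<in> pverts T" for z
    using that p(4) by (auto simp: T_def N_def \<beta>_def vx)
  then have "decomposition_width T \<beta> \<le> int t"
    using decomposition_width_le_iff[OF tree_graph_verts[OF tg]] by blast
  ultimately show ?thesis using that by blast
qed

text \<open>Vertices are ordered by the rank of the topmost node of their subtree, with ties broken.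
  The clique of \<open>v\<close> is the part of the bag at that node that does not come after
  \<open>v\<close>. Two vertices sharing a bag have intersecting subtrees, so the earlier one is
  present at the top of the later one.\<close>

lemma tree_decomposition_peo:
  assumes G: "pair_graph G" and T: "tree_decomposition G T \<beta>" and width: "decomposition_width T \<beta> \<le> int t"
  obtains rk B where "peo G rk B t"
proof -
  let ?V = "pverts G"
  have fin: "finite ?V" using pair_graphD(1)[OF G] .
  have tg: "tree_graph T" and sub: "\<And>z. z \<in> pverts T \<Longrightarrow> \<beta> z \<subseteq> ?V"
    and cover: "\<And>u v. (u, v) \<in> parcs G \<Longrightarrow> \<exists>z \<in> pverts T. u \<in> \<beta> z \<and> v \<in> \<beta> z"
    and conn: "\<And>v. v \<in> ?V \<Longrightarrow> Digraph_Component.connected (with_proj T \<restriction> {z \<in> pverts T. v \<in> \<beta> z})"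
    using T by (auto simp: tree_decomposition_def)
  obtain r p h where pt: "parent_tree T r p h" using tree_graph_parent_tree[OF tg] .
  define S where "S v = {z \<in> pverts T. v \<in> \<beta> z}" for v
  have "\<forall>v \<in> ?V. \<exists>s \<in> S v. \<forall>x \<in> S v. x \<noteq> s \<longrightarrow> x \<noteq> r \<and> p x \<in> S v"
    unfolding S_def by (intro ballI parent_tree_connected_top[OF pt _ conn]) auto
  then obtain top where top: "\<And>v. v \<in> ?V \<Longrightarrow> top v \<in> S v"
    and up: "\<And>v x. v \<in> ?V \<Longrightarrow> x \<in> S v \<Longrightarrow> x \<noteq> top v \<Longrightarrow> x \<noteq> r \<and> p x \<in> S v"
    by metis
  have SV: "z \<in> pverts T" if "z \<in> S v" for z v using that by (simp add: S_def)
  have top_less: "h (top v) < h z" if "v \<in> ?V" "z \<in> S v" "z \<noteq> top v" for v z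
    using that(2,3)
  proof (induction "h z" arbitrary: z rule: less_induct)
    case less
    then have z: "z \<noteq> r" "p z \<in> S v" using up[OF that(1)] by auto
    then have "h (p z) < h z" using parent_treeD(4)[OF pt] SV less.prems(1) by blast
    then show ?case using less.hyps[of "p z"] z(2) by (cases "p z = top v") auto
  qed
  \<comment> \<open>Going up from a common node of two subtrees, the lower of the two tops is met first.\<close>
  have climb: "top u \<in> S w" if "u \<in> ?V" "w \<in> ?V" "h (top w) \<le> h (top u)" "z \<in> S u" "z \<in> S w" for u w z
    using that(4,5)
  proof (induction "h z" arbitrary: z rule: less_induct)
    case less
    show ?case
    proof (cases "z = top u")
      case False
      then have "h (top u) < h z" using top_less that(1) less.prems(1) by blast
      then have "z \<noteq> top w" using that(3) by auto
      then have "p z \<in> S u" "p z \<in> S w" "z \<noteq> r" using up that(1,2) less.prems False by blast+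
      then show ?thesis using less.hyps[of "p z"] parent_treeD(4)[OF pt] SV less.prems(1) by blast
    qed (use less.prems in simp)
  qed
  obtain rk :: "_ \<Rightarrow> nat" where rk: "inj_on rk ?V"
    and rk_less: "\<And>v w. v \<in> ?V \<Longrightarrow> w \<in> ?V \<Longrightarrow> h (top v) < h (top w) \<Longrightarrow> rk v < rk w"
    using finite_tie_breaking[OF fin, of "\<lambda>v. h (top v)"] by blast
  have rk_le: "h (top w) \<le> h (top u)" if "w \<in> ?V" "u \<in> ?V" "rk w \<le> rk u" for w u
    using rk_less[OF that(2,1)] that(3) by (meson leD leI)
  define B where "B v = {w \<in> \<beta> (top v). rk w \<le> rk v}" for v
  have topT: "top v \<in> pverts T" "v \<in> \<beta> (top v)" if "v \<in> ?V" for v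
    using top[OF that] by (auto simp: S_def)
  have B_card: "card (B v) \<le> Suc t" if "v \<in> ?V" for v
  proof -
    have "B v \<subseteq> \<beta> (top v)" by (auto simp: B_def)
    then have "card (B v) \<le> card (\<beta> (top v))"
      using sub[OF topT(1)[OF that]] fin by (meson card_mono finite_subset)
    also have "\<dots> \<le> Suc t"
      using width decomposition_width_le_iff[OF tree_graph_verts[OF tg]] topT(1)[OF that] by auto
    finally show ?thesis .
  qed
  have elim: "w \<in> B u" if "z \<in> pverts T" "w \<in> \<beta> z" "u \<in> \<beta> z" "rk w \<le> rk u" for z w u
  proof -
    have V: "w \<in> ?V" "u \<in> ?V" using sub that by auto
    have "top u \<in> S w" by (rule climb[OF V(2,1) rk_le[OF V that(4)], of z]) (use that in \<open>auto simp: S_def\<close>)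
    then show ?thesis using that(4) by (simp add: B_def S_def)
  qed
  have edges: "u \<in> B v \<or> v \<in> B u" if "(u, v) \<in> parcs G" for u v
    using cover[OF that] elim by (meson linear)
  have B_sub: "B v \<subseteq> ?V" "v \<in> B v" if "v \<in> ?V" for v
    using that topT sub by (auto simp: B_def)
  have B_elim: "w \<in> B u" if "v \<in> ?V" "w \<in> B v" "u \<in> B v" "rk w \<le> rk u" for v w u
    using that elim topT by (auto simp: B_def)
  have "peo G rk B t"
    unfolding peo_def
  proof (intro conjI ballI impI)
    show "case e of (u, v) \<Rightarrow> u \<in> B v \<or> v \<in> B u" if "e \<in> parcs G" for e
      using edges that by (cases e) simp
    show "rk w \<le> rk v" if "w \<in> B v" for v w
      using that by (simp add: B_def)
  qed (fact rk | erule B_sub B_card | erule B_elim; assumption)+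
  then show ?thesis using that by blast
qed

lemma tree_width_le_iff_peo:
  fixes G :: "'a pair_pre_digraph"
  assumes G: "pair_graph G"
  shows "tree_width G \<le> int t \<longleftrightarrow> (\<exists>rk B. peo G rk B t)"
proof -
  let ?P = "\<lambda>w. \<exists>(T :: nat pair_pre_digraph) \<beta>. tree_decomposition G T \<beta> \<and> decomposition_width T \<beta> = w"
  have bound: "- 1 \<le> w" if "?P w" for w
    using that decomposition_width_ge tree_graph_verts unfolding tree_decomposition_def by metis
  show ?thesis
  proof
    assume "\<exists>rk B. peo G rk B t"
    then obtain T :: "nat pair_pre_digraph" and \<beta> where "tree_decomposition G T \<beta>"
      "decomposition_width T \<beta> \<le> int t" using peo_tree_decomposition[OF G] by metis
    moreover from this have "(LEAST w. ?P w) \<le> decomposition_width T \<beta>"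
      using bound by (intro Least_int_bounded(2)[of ?P _ "- 1"]) blast+
    ultimately show "tree_width G \<le> int t" unfolding tree_width_def by linarith
  next
    assume le: "tree_width G \<le> int t"
    have fin: "finite (pverts G)" using pair_graphD(1)[OF G] .
    obtain rk :: "'a \<Rightarrow> nat" where "inj_on rk (pverts G)"
      using finite_imp_inj_to_nat_seg[OF fin] by blast
    moreover have "card {w \<in> pverts G. rk w \<le> rk v} \<le> card (pverts G)" for v
      using fin by (auto intro: card_mono)
    \<comment> \<open>Taking all earlier vertices as the clique always gives an elimination
      ordering, so some decomposition exists and the minimum in \<open>tree_width\<close> is
      attained.\<close>
    ultimately have "peo G rk (\<lambda>v. {w \<in> pverts G. rk w \<le> rk v}) (card (pverts G))"
      using pair_graphD(2)[OF G] by (auto simp: peo_def intro: le_SucI)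
    then obtain T :: "nat pair_pre_digraph" and \<beta> where "tree_decomposition G T \<beta>"
      using peo_tree_decomposition[OF G] by metis
    then have "?P (tree_width G)"
      unfolding tree_width_def using bound by (intro Least_int_bounded(1)[of ?P _ "- 1"]) blast+
    then show "\<exists>rk B. peo G rk B t"
      using tree_decomposition_peo[OF G] le by metis
  qed
qed

section \<open>Greedy coloring, chromatic number and cliques\<close>

text \<open>Greedy coloring in rank order: at most \<open>t\<close> other vertices of the clique are
  colored before \<open>v\<close>, so one of the \<open>t + 1\<close> colors is free. This gives the
  finiteness of the set behind \<open>max_chromatic_number\<close>.\<close>

lemma peo_coloring:
  assumes G: "pair_graph G" and peo: "peo G rk B t"
  obtains \<phi> where "proper_coloring G \<phi>" "\<phi> ` pverts G \<subseteq> {0..int t}"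
proof -
  let ?V = "pverts G"
  note p = peoD[OF peo]
  have fin: "finite ?V" using pair_graphD(1)[OF G] .
  have "\<exists>\<phi> :: _ \<Rightarrow> int. \<forall>v \<in> ?V. rk v < n \<longrightarrow> \<phi> v \<in> {0..int t} \<and> (\<forall>u \<in> B v - {v}. \<phi> u \<noteq> \<phi> v)" for n
  proof (induction n)
    case (Suc n)
    then obtain \<phi> :: "_ \<Rightarrow> int" where \<phi>: "\<And>v. v \<in> ?V \<Longrightarrow> rk v < n \<Longrightarrow>
      \<phi> v \<in> {0..int t} \<and> (\<forall>u \<in> B v - {v}. \<phi> u \<noteq> \<phi> v)" by blast
    show ?case
    proof (cases "\<exists>v \<in> ?V. rk v = n")
      case True
      then obtain v where v: "v \<in> ?V" "rk v = n" by blast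
      have finB: "finite (B v)" using p(3)[OF v(1)] fin finite_subset by blast
      have "card (\<phi> ` (B v - {v})) \<le> card (B v - {v})" using finB by (simp add: card_image_le)
      also have "\<dots> < card {0..int t}"
        using p(2,4)[OF v(1)] finB by (simp add: card_Diff_singleton)
      finally have "\<not> {0..int t} \<subseteq> \<phi> ` (B v - {v})"
        using finB by (meson card_mono finite_Diff finite_imageI leD)
      then obtain c where c: "c \<in> {0..int t}" "c \<notin> \<phi> ` (B v - {v})" by blast
      have "(\<phi>(v := c)) w \<in> {0..int t} \<and> (\<forall>u \<in> B w - {w}. (\<phi>(v := c)) u \<noteq> (\<phi>(v := c)) w)"
        if w: "w \<in> ?V" "rk w < Suc n" for w
      proof (cases "w = v")
        case True
        then show ?thesis using c by auto
      next
        case False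
        then have "rk w < n" using w v p(1) by (metis inj_onD less_Suc_eq)
        \<comment> \<open>\<open>v\<close> has the highest rank so far, so no earlier clique
          contains it and setting its color disturbs nothing.\<close>
        moreover from this have "v \<notin> B w" using p(5)[OF w(1)] v(2) by (meson leD)
        ultimately show ?thesis using \<phi>[OF w(1)] False by auto
      qed
      then show ?thesis by blast
    next
      case False
      then show ?thesis using \<phi> less_Suc_eq by metis
    qed
  qed auto
  from this[of "Suc (Max (rk ` ?V))"] obtain \<phi> :: "_ \<Rightarrow> int" where \<phi>: "\<And>v. v \<in> ?V \<Longrightarrow>
      \<phi> v \<in> {0..int t} \<and> (\<forall>u \<in> B v - {v}. \<phi> u \<noteq> \<phi> v)"
    using fin by (auto simp: less_Suc_eq_le)
  have "proper_coloring G \<phi>"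
    unfolding proper_coloring_def
  proof (clarify)
    fix u v assume uv: "(u, v) \<in> parcs G" "\<phi> u = \<phi> v"
    then have "u \<in> ?V" "v \<in> ?V" "u \<noteq> v" using pair_graphD(2,4)[OF G] by auto
    then show False using p(7)[OF uv(1)] \<phi> uv(2) by (metis DiffI singletonD)
  qed
  then show ?thesis using that \<phi> by blast
qed

lemma chromatic_number_le:
  "proper_coloring G \<phi> \<Longrightarrow> chromatic_number G \<le> num_colors G \<phi>"
  unfolding chromatic_number_def by (rule Least_le) blast

lemma chromatic_number_attained:
  assumes "pair_graph G"
  obtains \<phi> where "proper_coloring G \<phi>" "num_colors G \<phi> = chromatic_number G"
proof -
  obtain e :: "_ \<Rightarrow> nat" where e: "inj_on e (pverts G)"
    using finite_imp_inj_to_nat_seg[OF pair_graphD(1)[OF assms]] by blast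
  have "proper_coloring G (\<lambda>v. int (e v))"
    unfolding proper_coloring_def
  proof (clarify)
    fix u v assume uv: "(u, v) \<in> parcs G" "int (e u) = int (e v)"
    then have "u = v" using pair_graphD(2)[OF assms] inj_onD[OF e, of u v] by auto
    then show False using uv(1) pair_graphD(4)[OF assms] by simp
  qed
  then have "\<exists>n \<phi>. proper_coloring G \<phi> \<and> num_colors G \<phi> = n" by blast
  from LeastI_ex[OF this] show ?thesis using that unfolding chromatic_number_def by blast
qed

lemma chromatic_number_le_tree_width:
  assumes "pair_graph G" "tree_width G \<le> int t"
  shows "chromatic_number G \<le> Suc t"
proof -
  obtain rk B where "peo G rk B t" using assms tree_width_le_iff_peo by blast
  from peo_coloring[OF assms(1) this] obtain \<phi> where
    \<phi>: "proper_coloring G \<phi>" "\<phi> ` pverts G \<subseteq> {0..int t}" by blast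
  have "num_colors G \<phi> \<le> card {0..int t}"
    unfolding num_colors_def using \<phi>(2) by (intro card_mono) auto
  then show ?thesis using chromatic_number_le[OF \<phi>(1)] by simp
qed

lemma chromatic_number_le_max:
  fixes G :: "'v pair_pre_digraph"
  assumes "pair_graph G" "clique_free k G" "tree_width G \<le> int t"
  shows "chromatic_number G \<le> max_chromatic_number TYPE('v) t k"
  unfolding max_chromatic_number_def
proof (rule Max_ge)
  show "finite {chromatic_number G |G :: 'v pair_pre_digraph. pair_graph G \<and> clique_free k G \<and> tree_width G \<le> int t}"
    by (rule finite_subset[of _ "{..Suc t}"]) (auto intro: chromatic_number_le_tree_width)
qed (use assms in blast)

text \<open>Cliques as vertex sets are easily carried along injections and induced subgraphs; the
  complete graph on such a set is the required subgraph.\<close>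

lemma clique_free_iff:
  assumes G: "pair_graph G"
  shows "clique_free k G \<longleftrightarrow>
    \<not> (\<exists>X. X \<subseteq> pverts G \<and> card X = k \<and> (\<forall>u \<in> X. \<forall>v \<in> X. u \<noteq> v \<longrightarrow> (u, v) \<in> parcs G))"
proof -
  have "(\<exists>H. subgraph (with_proj H) (with_proj G) \<and> K\<^bsub>k\<^esub> (with_proj H)) \<longleftrightarrow>
    (\<exists>X. X \<subseteq> pverts G \<and> card X = k \<and> (\<forall>u \<in> X. \<forall>v \<in> X. u \<noteq> v \<longrightarrow> (u, v) \<in> parcs G))"
  proof
    assume "\<exists>H. subgraph (with_proj H) (with_proj G) \<and> K\<^bsub>k\<^esub> (with_proj H)"
    then obtain H where H: "subgraph (with_proj H) (with_proj G)" "K\<^bsub>k\<^esub> (with_proj H)" by blast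
    then show "\<exists>X. X \<subseteq> pverts G \<and> card X = k \<and> (\<forall>u \<in> X. \<forall>v \<in> X. u \<noteq> v \<longrightarrow> (u, v) \<in> parcs G)"
      by (intro exI[of _ "pverts H"]) (auto simp: subgraph_def complete_digraph_pair_def)
  next
    assume "\<exists>X. X \<subseteq> pverts G \<and> card X = k \<and> (\<forall>u \<in> X. \<forall>v \<in> X. u \<noteq> v \<longrightarrow> (u, v) \<in> parcs G)"
    then obtain X where X: "X \<subseteq> pverts G" "card X = k"
      "\<And>u v. u \<in> X \<Longrightarrow> v \<in> X \<Longrightarrow> u \<noteq> v \<Longrightarrow> (u, v) \<in> parcs G" by blast
    let ?H = "\<lparr>pverts = X, parcs = {(u, v). (u, v) \<in> X \<times> X \<and> u \<noteq> v}\<rparr>"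
    have "finite X" using X(1) pair_graphD(1)[OF G] finite_subset by blast
    then have "K\<^bsub>k\<^esub> (with_proj ?H)" using X(2) by (simp add: complete_digraph_pair_def)
    moreover have "subgraph (with_proj ?H) (with_proj G)"
    proof (rule subgraphI)
      show "wf_digraph (with_proj ?H)" by (auto simp: wf_digraph_def)
      show "wf_digraph (with_proj G)" using pair_graphD(2)[OF G] by (auto simp: wf_digraph_def)
    qed (use X in auto)
    ultimately show "\<exists>H. subgraph (with_proj H) (with_proj G) \<and> K\<^bsub>k\<^esub> (with_proj H)" by blast
  qed
  then show ?thesis by (simp add: clique_free_def)
qed

section \<open>Nice path decompositions\<close>

lemma set_vwalk_arcs: "set (vwalk_arcs P) = {(P ! i, P ! Suc i) | i. Suc i < length P}"
proof (induction P rule: vwalk_arcs.induct)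
  case (3 x y xs)
  have "{(((x # y # xs) ! i), (x # y # xs) ! Suc i) | i. Suc i < length (x # y # xs)} =
    insert (x, y) {((y # xs) ! i, (y # xs) ! Suc i) | i. Suc i < length (y # xs)}" (is "?L = ?R")
  proof
    show "?L \<subseteq> ?R"
    proof
      fix e assume "e \<in> ?L"
      then obtain i where i: "e = ((x # y # xs) ! i, (x # y # xs) ! Suc i)" "Suc i < length (x # y # xs)"
        by blast
      then show "e \<in> ?R" by (cases i) auto
    qed
    show "?R \<subseteq> ?L"
    proof
      fix e assume "e \<in> ?R"
      then consider "e = (x, y)" | i where "e = ((y # xs) ! i, (y # xs) ! Suc i)" "Suc i < length (y # xs)"
        by blast
      then show "e \<in> ?L"
      proof cases
        case 1
        then show ?thesis by (intro CollectI exI[of _ 0]) simp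
      next
        case (2 i)
        then show ?thesis by (intro CollectI exI[of _ "Suc i"]) simp
      qed
    qed
  qed
  then show ?case using 3 by simp
qed simp_all

text \<open>Rooting the path at its first node turns the connectedness of occurrences into a
  condition on predecessors.\<close>

lemma path_graph_parent_tree:
  assumes P: "P \<noteq> []" "distinct P"
  obtains p h where "parent_tree (path_graph P) (P ! 0) p h"
    and "\<And>i. i < length P \<Longrightarrow> p (P ! i) = P ! (i - 1)"
proof -
  define h where "h = inv_into {..<length P} ((!) P)"
  define p where "p z = P ! (h z - 1)" for z
  have h: "h (P ! i) = i" if "i < length P" for i
    unfolding h_def using that P(2) by (intro inv_into_f_f inj_onI) (auto simp: nth_eq_iff_index_eq)
  then have p: "p (P ! i) = P ! (i - 1)" if "i < length P" for i
    using that by (simp add: p_def)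
  have ne: "set P - {P ! 0} = {P ! Suc i | i. Suc i < length P}"
  proof
    show "set P - {P ! 0} \<subseteq> {P ! Suc i | i. Suc i < length P}"
    proof
      fix z assume "z \<in> set P - {P ! 0}"
      then obtain i where "i < length P" "z = P ! i" "i \<noteq> 0" by (auto simp: in_set_conv_nth)
      then show "z \<in> {P ! Suc i | i. Suc i < length P}" by (cases i) auto
    qed
    show "{P ! Suc i | i. Suc i < length P} \<subseteq> set P - {P ! 0}"
      using P by (auto simp: nth_eq_iff_index_eq)
  qed
  have "set (vwalk_arcs P) = (\<lambda>x. (p x, x)) ` (set P - {P ! 0})"
    unfolding set_vwalk_arcs ne using p by (force simp: image_iff)
  moreover from this have "(set (vwalk_arcs P))\<inverse> = (\<lambda>x. (x, p x)) ` (set P - {P ! 0})"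
    by auto
  moreover have "p x \<in> set P \<and> h (p x) < h x" if "x \<in> set P - {P ! 0}" for x
    using that h p unfolding ne by auto
  ultimately have "parent_tree (path_graph P) (P ! 0) p h"
    using P(1) unfolding parent_tree_def path_graph_def by auto
  then show ?thesis using that p by blast
qed

text \<open>Nested bags replace connectedness: apart from the covering of arcs, every condition on
  later bags compares a bag with the preceding one, and \<open>v j\<close> is the vertex introduced
  at position \<open>j\<close>. This form passes easily to prefixes and is easy to check for a
  constructed decomposition; the link with \<open>nice_path_decomposition\<close> is proved below in
  both directions.\<close>

definition nice_sequence ::
    "'v pair_pre_digraph \<Rightarrow> 'n list \<Rightarrow> ('n \<Rightarrow> 'v set) \<Rightarrow> (nat \<Rightarrow> 'v) \<Rightarrow> bool" where
  "nice_sequence G P \<beta> v \<longleftrightarrow> P \<noteq> [] \<and> distinct P \<and> \<beta> (P ! 0) = {} \<and>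
    inj_on v {1..length P - 1} \<and> pverts G = v ` {1..length P - 1} \<and>
    (\<forall>j \<in> {1..length P - 1}. v j \<in> \<beta> (P ! j) \<and> \<beta> (P ! j) - {v j} \<subseteq> \<beta> (P ! (j - 1))) \<and>
    (\<forall>i \<in> {1..length P - 1}. \<forall>j \<in> {1..length P - 1}.
      i < j \<longrightarrow> (v i, v j) \<in> parcs G \<longrightarrow> v i \<in> \<beta> (P ! j))"

lemma nice_sequenceD:
  assumes "nice_sequence G P \<beta> v"
  shows "P \<noteq> []" "distinct P" "\<beta> (P ! 0) = {}" "inj_on v {1..length P - 1}"
    and "pverts G = v ` {1..length P - 1}"
    and "1 \<le> j \<Longrightarrow> j < length P \<Longrightarrow> v j \<in> \<beta> (P ! j)"
    and "1 \<le> j \<Longrightarrow> j < length P \<Longrightarrow> \<beta> (P ! j) - {v j} \<subseteq> \<beta> (P ! (j - 1))"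
    and "1 \<le> i \<Longrightarrow> i < j \<Longrightarrow> j < length P \<Longrightarrow> (v i, v j) \<in> parcs G \<Longrightarrow> v i \<in> \<beta> (P ! j)"
proof -
  show "P \<noteq> []" "distinct P" "\<beta> (P ! 0) = {}" "inj_on v {1..length P - 1}"
    "pverts G = v ` {1..length P - 1}"
    using assms by (simp_all add: nice_sequence_def)
  show "1 \<le> j \<Longrightarrow> j < length P \<Longrightarrow> v j \<in> \<beta> (P ! j)"
    "1 \<le> j \<Longrightarrow> j < length P \<Longrightarrow> \<beta> (P ! j) - {v j} \<subseteq> \<beta> (P ! (j - 1))"
    using assms unfolding nice_sequence_def by auto
  show "v i \<in> \<beta> (P ! j)" if "1 \<le> i" "i < j" "j < length P" "(v i, v j) \<in> parcs G"
  proof -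
    have "i \<in> {1..length P - 1}" "j \<in> {1..length P - 1}" using that by auto
    then show ?thesis using assms that unfolding nice_sequence_def by blast
  qed
qed

lemma nice_sequence_bag:
  assumes "nice_sequence G P \<beta> v" "j < length P"
  shows "\<beta> (P ! j) \<subseteq> v ` {1..j}"
  using assms(2)
proof (induction j)
  case 0
  then show ?case using nice_sequenceD(3)[OF assms(1)] by simp
next
  case (Suc j)
  then have "\<beta> (P ! j) \<subseteq> v ` {1..j}" "\<beta> (P ! Suc j) - {v (Suc j)} \<subseteq> \<beta> (P ! j)"
    using nice_sequenceD(7)[OF assms(1), of "Suc j"] by simp_all
  then show ?case by (auto simp: atLeastAtMostSuc_conv)
qed

lemma nice_sequence_inj:
  assumes "nice_sequence G P \<beta> v" "1 \<le> i" "i < length P" "1 \<le> j" "j < length P"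
  shows "v i = v j \<longleftrightarrow> i = j"
  using inj_onD[OF nice_sequenceD(4)[OF assms(1)], of i j] assms(2-) by auto

lemma nice_sequence_bag_le:
  assumes "nice_sequence G P \<beta> v" "1 \<le> i" "i < length P" "j < length P" "v i \<in> \<beta> (P ! j)"
  shows "i \<le> j"
proof -
  obtain i' where "i' \<in> {1..j}" "v i = v i'" using nice_sequence_bag assms by blast
  then show ?thesis using nice_sequence_inj[OF assms(1-3), of i'] assms(4) by auto
qed

lemma nice_sequence_new:
  assumes "nice_sequence G P \<beta> v" "1 \<le> j" "j < length P"
  shows "\<beta> (P ! j) - \<beta> (P ! (j - 1)) = {v j}"
proof -
  have "v j \<notin> \<beta> (P ! (j - 1))"
  proof
    assume "v j \<in> \<beta> (P ! (j - 1))"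
    then have "j \<le> j - 1" using assms(3) by (intro nice_sequence_bag_le[OF assms]) simp_all
    then show False using assms(2) by simp
  qed
  then show ?thesis using nice_sequenceD(6,7)[OF assms] by auto
qed

lemma nice_sequence_introduced:
  assumes "nice_sequence G P \<beta> v" "1 \<le> j" "j < length P"
  shows "introduced P \<beta> j = v j"
  using nice_sequence_new[OF assms] by (simp add: introduced_def)

text \<open>Passing from position \<open>Suc m\<close> back to \<open>m\<close>, only
  \<open>v (Suc m)\<close> can leave the bag, and \<open>i \<le> m\<close> makes it different from
  \<open>v i\<close>.\<close>

lemma nice_sequence_interval:
  assumes "nice_sequence G P \<beta> v" "1 \<le> i" "i \<le> j" "j \<le> m" "m < length P" "v i \<in> \<beta> (P ! m)"
  shows "v i \<in> \<beta> (P ! j)"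
  using assms(4-)
proof (induction rule: dec_induct)
  case (step m)
  have "v i \<noteq> v (Suc m)"
    using nice_sequence_inj[OF assms(1), of i "Suc m"] assms(2,3) step by auto
  then have "v i \<in> \<beta> (P ! m)"
    using nice_sequenceD(7)[OF assms(1), of "Suc m"] step.prems by auto
  then show ?case using step by auto
qed

text \<open>The occurrences of \<open>v i\<close> have their top at \<open>P ! i\<close>: at any
  later occurrence the vertex also lies in the preceding bag.\<close>

lemma nice_path_decomposition_if_sequence:
  assumes G: "pair_graph G" and s: "nice_sequence G P \<beta> v"
  shows "nice_path_decomposition G P \<beta>"
proof -
  note d = nice_sequenceD[OF s]
  obtain p h where pt: "parent_tree (path_graph P) (P ! 0) p h"
    and p: "\<And>i. i < length P \<Longrightarrow> p (P ! i) = P ! (i - 1)"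
    using path_graph_parent_tree[OF d(1,2)] by metis
  let ?n = "length P - 1"
  have verts: "pverts (path_graph P) = set P" by (simp add: path_graph_def)
  have lt: "j < length P" if "j \<in> {1..?n}" for j using that by auto
  have "\<beta> z \<subseteq> pverts G" if z: "z \<in> set P" for z
  proof -
    obtain j where j: "j < length P" "z = P ! j" using z by (auto simp: in_set_conv_nth)
    then have "\<beta> z \<subseteq> v ` {1..j}" using nice_sequence_bag[OF s] by simp
    also have "\<dots> \<subseteq> pverts G" unfolding d(5) using j by (intro image_mono) auto
    finally show ?thesis .
  qed
  moreover have "\<exists>z \<in> set P. {a, b} \<subseteq> \<beta> z" if ab: "(a, b) \<in> parcs G" for a b
  proof -
    have "a \<in> pverts G" "b \<in> pverts G" "a \<noteq> b" using ab pair_graphD(2,4)[OF G] by auto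
    then obtain i j where ij: "i \<in> {1..?n}" "j \<in> {1..?n}" "a = v i" "b = v j" "i \<noteq> j"
      unfolding d(5) by blast
    have "(b, a) \<in> parcs G" using ab pair_graphD(3)[OF G] by blast
    show ?thesis
    proof (cases "i < j")
      case True
      then have "{a, b} \<subseteq> \<beta> (P ! j)" using ij ab d(6)[of j] d(8)[of i j] lt[OF ij(2)] by simp
      then show ?thesis using lt[OF ij(2)] nth_mem by blast
    next
      case False
      then have "{a, b} \<subseteq> \<beta> (P ! i)"
        using ij \<open>(b, a) \<in> parcs G\<close> d(6)[of i] d(8)[of j i] lt[OF ij(1)] by simp
      then show ?thesis using lt[OF ij(1)] nth_mem by blast
    qed
  qed
  moreover have "Digraph_Component.connected (with_proj (path_graph P) \<restriction> {z \<in> set P. u \<in> \<beta> z})"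
    if u: "u \<in> pverts G" for u
  proof -
    obtain i where i: "i \<in> {1..?n}" "u = v i" using u d(5) by auto
    show ?thesis
    proof (rule parent_tree_connected_induce[OF pt])
      show "P ! i \<in> {z \<in> set P. u \<in> \<beta> z}" using d(6) lt[OF i(1)] i by auto
      fix z assume z: "z \<in> {z \<in> set P. u \<in> \<beta> z}" "z \<noteq> P ! i"
      then obtain j where j: "j < length P" "z = P ! j" "u \<in> \<beta> (P ! j)" "j \<noteq> i"
        by (auto simp: in_set_conv_nth)
      have ij: "1 \<le> i" "i \<le> j - 1" "j - 1 < length P"
        using nice_sequence_bag_le[OF s _ lt[OF i(1)] j(1)] i j by auto
      then have "u \<in> \<beta> (P ! (j - 1))"
        using nice_sequence_interval[OF s ij(1,2) _ j(1)] i(2) j(3) by simp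
      moreover have "z \<noteq> P ! 0" using d(3) j(2,3) by auto
      ultimately show "z \<noteq> P ! 0 \<and> p z \<in> {z \<in> set P. u \<in> \<beta> z}"
        using p j ij by auto
    qed (auto simp: verts)
  qed
  ultimately have "tree_decomposition G (path_graph P) \<beta>"
    using parent_tree_tree_graph[OF pt] by (auto simp: tree_decomposition_def verts)
  moreover have "card (\<beta> (P ! i) - \<beta> (P ! (i - 1))) = 1" if "i \<in> {1..?n}" for i
    using nice_sequence_new[OF s _ lt[OF that]] that by simp
  ultimately show ?thesis
    using d(1-3) by (simp add: nice_path_decomposition_def path_decomposition_def)
qed

text \<open>A connected set of positions has just one member whose predecessor is missing. So a
  vertex is introduced only once and stays from there until its last occurrence.\<close>

lemma nice_path_decomposition_sequence:
  assumes G: "pair_graph G" and nice: "nice_path_decomposition G P \<beta>"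
  shows "nice_sequence G P \<beta> (introduced P \<beta>)"
proof -
  let ?n = "length P - 1" and ?v = "introduced P \<beta>"
  have P: "P \<noteq> []" "distinct P" and T: "tree_decomposition G (path_graph P) \<beta>"
    and root: "\<beta> (P ! 0) = {}"
    and card: "\<And>i. i \<in> {1..?n} \<Longrightarrow> card (\<beta> (P ! i) - \<beta> (P ! (i - 1))) = 1"
    using nice by (auto simp: nice_path_decomposition_def path_decomposition_def)
  obtain p h where pt: "parent_tree (path_graph P) (P ! 0) p h"
    and p: "\<And>i. i < length P \<Longrightarrow> p (P ! i) = P ! (i - 1)"
    using path_graph_parent_tree[OF P] by metis
  have verts: "pverts (path_graph P) = set P" by (simp add: path_graph_def)
  have lt: "j < length P" if "j \<in> {1..?n}" for j using that by auto
  have sub: "\<beta> (P ! j) \<subseteq> pverts G" if "j < length P" for j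
    using T that by (auto simp: tree_decomposition_def verts)
  have new: "\<beta> (P ! j) - \<beta> (P ! (j - 1)) = {?v j}" if "j \<in> {1..?n}" for j
    using card[OF that] unfolding introduced_def by (metis card_1_singletonE the_elem_eq)
  have pred: "u \<in> \<beta> (P ! (j - 1))"
    if i: "i \<in> {1..?n}" "u = ?v i" and j: "j < length P" "u \<in> \<beta> (P ! j)" "j \<noteq> i" for u i j
  proof -
    let ?S = "{z \<in> set P. u \<in> \<beta> z}"
    have u: "u \<in> \<beta> (P ! i)" "u \<notin> \<beta> (P ! (i - 1))" using new[OF i(1)] i(2) by auto
    then have "u \<in> pverts G" using sub lt[OF i(1)] by blast
    then have conn: "Digraph_Component.connected (with_proj (path_graph P) \<restriction> ?S)"
      using T by (auto simp: tree_decomposition_def verts)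
    have S: "?S \<subseteq> pverts (path_graph P)" by (auto simp: verts)
    obtain s where s: "\<And>x. x \<in> ?S \<Longrightarrow> x \<noteq> s \<Longrightarrow> x \<noteq> P ! 0 \<and> p x \<in> ?S"
      using parent_tree_connected_top[OF pt S conn] by blast
    have "p (P ! i) \<notin> ?S" using p[OF lt[OF i(1)]] u(2) by simp
    moreover have "P ! i \<in> ?S" using u(1) lt[OF i(1)] by simp
    ultimately have "s = P ! i" using s by blast
    moreover have "P ! j \<noteq> P ! i" using P(2) j(1,3) lt[OF i(1)] by (simp add: nth_eq_iff_index_eq)
    moreover have "P ! j \<in> ?S" using j(1,2) by simp
    ultimately have "p (P ! j) \<in> ?S" using s by blast
    then show ?thesis using p[OF j(1)] by simp
  qed
  have le: "i \<le> j" if i: "i \<in> {1..?n}" and j: "j < length P" "?v i \<in> \<beta> (P ! j)" for i j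
  proof (rule ccontr)
    assume "\<not> i \<le> j"
    then have "j < i" by simp
    with j show False
    proof (induction j)
      case (Suc j)
      then show ?case using pred[OF i refl, of "Suc j"] by simp
    qed (use root in simp)
  qed
  have interval: "?v i \<in> \<beta> (P ! j)"
    if i: "i \<in> {1..?n}" and j: "j \<le> m" "i \<le> j" "m < length P" "?v i \<in> \<beta> (P ! m)" for i j m
    using j(1,3,4)
  proof (induction rule: dec_induct)
    case (step m)
    then show ?case using pred[OF i refl, of "Suc m"] j(2) by simp
  qed
  have "inj_on ?v {1..?n}"
  proof (rule inj_onI)
    fix i j assume ij: "i \<in> {1..?n}" "j \<in> {1..?n}" "?v i = ?v j"
    have "?v i \<in> \<beta> (P ! i)" "?v j \<in> \<beta> (P ! j)" using new ij by blast+
    then show "i = j" using le[OF ij(1) lt[OF ij(2)]] le[OF ij(2) lt[OF ij(1)]] ij(3) by simp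
  qed
  moreover have "pverts G = ?v ` {1..?n}"
  proof
    show "?v ` {1..?n} \<subseteq> pverts G" using new sub lt by blast
    show "pverts G \<subseteq> ?v ` {1..?n}"
    proof
      fix u assume "u \<in> pverts G"
      then have "Digraph_Component.connected (with_proj (path_graph P) \<restriction> {z \<in> set P. u \<in> \<beta> z})"
        using T by (auto simp: tree_decomposition_def verts)
      then have "{z \<in> set P. u \<in> \<beta> z} \<noteq> {}"
        using connected_induce_iff[OF parent_tree_pair_graph[OF pt]] verts by auto
      then obtain k where k: "k < length P \<and> u \<in> \<beta> (P ! k)" by (auto simp: in_set_conv_nth)
      \<comment> \<open>The first position whose bag contains \<open>u\<close>; it is not 0 because
        the first bag is empty, so \<open>u\<close> is introduced there.\<close>
      define j where "j = (LEAST j. j < length P \<and> u \<in> \<beta> (P ! j))"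
      have j: "j < length P" "u \<in> \<beta> (P ! j)"
        using LeastI[of "\<lambda>j. j < length P \<and> u \<in> \<beta> (P ! j)", OF k] by (auto simp: j_def)
      then have "j \<noteq> 0" using root by (metis empty_iff)
      then have "u \<notin> \<beta> (P ! (j - 1))"
        using not_less_Least[of "j - 1" "\<lambda>j. j < length P \<and> u \<in> \<beta> (P ! j)"] j(1)
        by (auto simp: j_def[symmetric])
      moreover have jn: "j \<in> {1..?n}" using j(1) \<open>j \<noteq> 0\<close> by auto
      ultimately have "u = ?v j" using new[OF jn] j(2) by blast
      then show "u \<in> ?v ` {1..?n}" using jn by blast
    qed
  qed
  moreover have "?v i \<in> \<beta> (P ! j)"
    if ij: "i \<in> {1..?n}" "j \<in> {1..?n}" "i < j" "(?v i, ?v j) \<in> parcs G" for i j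
  proof -
    obtain m where m: "m < length P" "?v i \<in> \<beta> (P ! m)" "?v j \<in> \<beta> (P ! m)"
      using T ij(4) by (fastforce simp: tree_decomposition_def verts in_set_conv_nth)
    then show ?thesis using interval[OF ij(1) le[OF ij(2) m(1,3)]] ij(3) by simp
  qed
  moreover have "?v j \<in> \<beta> (P ! j) \<and> \<beta> (P ! j) - {?v j} \<subseteq> \<beta> (P ! (j - 1))" if "j \<in> {1..?n}" for j
    using new[OF that] by blast
  ultimately show ?thesis using P root unfolding nice_sequence_def by blast
qed

section \<open>Prefixes of a decomposed graph and produced colorings\<close>

definition induced :: "'v pair_pre_digraph \<Rightarrow> 'v set \<Rightarrow> 'v pair_pre_digraph" where
  "induced G X = \<lparr>pverts = X, parcs = Restr (parcs G) X\<rparr>"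

lemma induced_simps [simp]:
  "pverts (induced G X) = X" "parcs (induced G X) = Restr (parcs G) X"
  by (simp_all add: induced_def)

lemma pair_graph_induced:
  assumes "pair_graph G" "X \<subseteq> pverts G"
  shows "pair_graph (induced G X)"
  using pair_graphD[OF assms(1)] assms(2) by (intro pair_graphI) (auto intro: finite_subset)

lemma clique_free_induced:
  assumes "pair_graph G" "X \<subseteq> pverts G" "clique_free k G"
  shows "clique_free k (induced G X)"
  using assms(2,3) unfolding clique_free_iff[OF assms(1)] clique_free_iff[OF pair_graph_induced[OF assms(1,2)]]
  by auto blast

lemma decomposition_prefix_eq:
  assumes G: "pair_graph G" and s: "nice_sequence G P \<beta> v" and i: "i < length P"
  shows "decomposition_prefix G P \<beta> i =
    (induced G (v ` {1..i}), take (Suc i) P, restrict \<beta> (set (take (Suc i) P)))"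
proof -
  let ?n = "length P - 1"
  have "introduced P \<beta> ` {i + 1..?n} = v ` {i + 1..?n}"
    using nice_sequence_introduced[OF s] by (intro image_cong) auto
  moreover have "pverts G - v ` {i + 1..?n} = v ` {1..i}"
  proof -
    have "v ` ({1..?n} - {i + 1..?n}) = v ` {1..?n} - v ` {i + 1..?n}"
      by (rule inj_on_image_set_diff[OF nice_sequenceD(4)[OF s]]) auto
    moreover have "{1..?n} - {i + 1..?n} = {1..i}" using i by auto
    ultimately show ?thesis unfolding nice_sequenceD(5)[OF s] by simp
  qed
  ultimately have "delete_verts G (introduced P \<beta> ` {i + 1..?n}) = induced G (v ` {1..i})"
    using pair_graphD(2)[OF G] unfolding delete_verts_def induced_def by auto
  then show ?thesis by (simp add: decomposition_prefix_def)
qed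

lemma nice_sequence_prefix:
  assumes s: "nice_sequence G P \<beta> v" and i: "i < length P"
  shows "nice_sequence (induced G (v ` {1..i})) (take (Suc i) P) (restrict \<beta> (set (take (Suc i) P))) v"
proof -
  note d = nice_sequenceD[OF s]
  define Q where "Q = take (Suc i) P"
  define \<gamma> where "\<gamma> = restrict \<beta> (set Q)"
  have Q: "Q \<noteq> []" "distinct Q" "length Q = Suc i" using d(1,2) i by (simp_all add: Q_def)
  have bag: "\<gamma> (Q ! j) = \<beta> (P ! j)" if "j \<le> i" for j
  proof -
    have "Q ! j \<in> set Q" using that Q(3) by (intro nth_mem) simp
    then show ?thesis using that by (simp add: \<gamma>_def) (simp add: Q_def)
  qed
  have "inj_on v {1..i}" by (rule inj_on_subset[OF d(4)]) (use i in auto)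
  moreover have "v j \<in> \<gamma> (Q ! j) \<and> \<gamma> (Q ! j) - {v j} \<subseteq> \<gamma> (Q ! (j - 1))" if "j \<in> {1..i}" for j
  proof -
    have "1 \<le> j" "j \<le> i" "j - 1 \<le> i" using that by auto
    then show ?thesis using d(6,7)[of j] i bag by simp
  qed
  moreover have "v m \<in> \<gamma> (Q ! j)" if "m \<in> {1..i}" "j \<in> {1..i}" "m < j" "(v m, v j) \<in> parcs G" for m j
    using d(8)[of m j] that i by (simp add: bag)
  moreover have "\<gamma> (Q ! 0) = {}" using bag[of 0] d(3) by simp
  ultimately have "nice_sequence (induced G (v ` {1..i})) Q \<gamma> v"
    using Q(1,2) unfolding nice_sequence_def Q(3) by simp
  then show ?thesis by (simp only: Q_def \<gamma>_def)
qed

text \<open>Restricting twice is the same as restricting once. This composition law is what makes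
  the prefix order on inputs a forest.\<close>

lemma decomposition_prefix_prefix:
  assumes G: "pair_graph G" and s: "nice_sequence G P \<beta> v" and i: "j \<le> i" "i < length P"
    and pre: "decomposition_prefix G P \<beta> i = (G', P', \<beta>')"
  shows "decomposition_prefix G' P' \<beta>' j = decomposition_prefix G P \<beta> j"
proof -
  have eq: "G' = induced G (v ` {1..i})" "P' = take (Suc i) P" "\<beta>' = restrict \<beta> (set (take (Suc i) P))"
    using pre decomposition_prefix_eq[OF G s i(2)] by auto
  have "v ` {1..i} \<subseteq> pverts G" using nice_sequenceD(5)[OF s] i by auto
  then have G': "pair_graph G'" unfolding eq by (rule pair_graph_induced[OF G])
  have s': "nice_sequence G' P' \<beta>' v" unfolding eq by (rule nice_sequence_prefix[OF s i(2)])
  have "induced G' (v ` {1..j}) = induced G (v ` {1..j})"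
    using i(1) by (auto simp: eq induced_def)
  moreover have "take (Suc j) P' = take (Suc j) P" using i(1) by (simp add: eq min_def)
  moreover have "restrict \<beta>' (set (take (Suc j) P)) = restrict \<beta> (set (take (Suc j) P))"
    using set_take_subset_set_take[of "Suc j" "Suc i" P] i(1) by (auto simp: eq restrict_def fun_eq_iff)
  ultimately show ?thesis
    using decomposition_prefix_eq[OF G' s', of j] decomposition_prefix_eq[OF G s, of j] i
    by (simp add: eq)
qed

lemma decomposition_prefix_full:
  assumes G: "pair_graph G" and s: "nice_sequence G P \<beta> v"
  shows "decomposition_prefix G P \<beta> (length P - 1) = (G, P, restrict \<beta> (set P))"
proof -
  have "induced G (v ` {1..length P - 1}) = G"
    unfolding nice_sequenceD(5)[OF s, symmetric] using pair_graphD(2)[OF G]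
    by (cases G) (auto simp: induced_def)
  then show ?thesis
    using decomposition_prefix_eq[OF G s, of "length P - 1"] nice_sequenceD(1)[OF s] by simp
qed

lemma produced_coloring_eq:
  assumes s: "nice_sequence G P \<beta> v" and j: "1 \<le> j" "j < length P"
  shows "produced_coloring A G P \<beta> (v j) = A (decomposition_prefix G P \<beta> j)"
proof -
  have "(THE i. i \<in> {1..length P - 1} \<and> introduced P \<beta> i = v j) = j"
  proof (rule the_equality)
    show "j \<in> {1..length P - 1} \<and> introduced P \<beta> j = v j"
      using nice_sequence_introduced[OF s j] j by auto
    fix i assume i: "i \<in> {1..length P - 1} \<and> introduced P \<beta> i = v j"
    then have "1 \<le> i" "i < length P" by auto
    then show "i = j"
      using i nice_sequence_introduced[OF s, of i] nice_sequence_inj[OF s _ _ j, of i] by simp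
  qed
  then show ?thesis by (simp add: produced_coloring_def)
qed

lemma path_graph_width_le_iff:
  assumes "P \<noteq> []"
  shows "decomposition_width (path_graph P) \<beta> \<le> int t \<longleftrightarrow> (\<forall>j < length P. card (\<beta> (P ! j)) \<le> Suc t)"
proof -
  have "pverts (path_graph P) = set P" by (simp add: path_graph_def)
  then show ?thesis
    using decomposition_width_le_iff[of "path_graph P" \<beta> t] assms by (simp add: all_set_conv_all_nth)
qed

section \<open>From an on-line algorithm to a coloring\<close>

text \<open>Say \<open>b\<close> occurs before the first \<open>a\<close>. The entries before the
  first \<open>b\<close> are then among those before the first \<open>a\<close> and miss
  \<open>b\<close>, so they form a smaller set. This is the injectivity behind the renaming of
  colors.\<close>

lemma card_takeWhile_neq:
  assumes "a \<in> set xs" "b \<in> set xs" "a \<noteq> b"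
  shows "card (set (takeWhile (\<lambda>x. x \<noteq> a) xs)) \<noteq> card (set (takeWhile (\<lambda>x. x \<noteq> b) xs))"
proof -
  have less: "card (set (takeWhile (\<lambda>x. x \<noteq> b) xs)) < card (set (takeWhile (\<lambda>x. x \<noteq> a) xs))"
    if "a \<in> set xs" "b \<in> set (takeWhile (\<lambda>x. x \<noteq> a) xs)" for a b :: 'a
  proof -
    let ?as = "takeWhile (\<lambda>x. x \<noteq> a) xs"
    have "takeWhile (\<lambda>x. x \<noteq> b) xs = takeWhile (\<lambda>x. x \<noteq> b) ?as"
      using takeWhile_append1[OF that(2), of "\<lambda>x. x \<noteq> b" "dropWhile (\<lambda>x. x \<noteq> a) xs"] by simp
    then have "set (takeWhile (\<lambda>x. x \<noteq> b) xs) \<subseteq> set ?as - {b}"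
      by (auto dest: set_takeWhileD)
    then have "set (takeWhile (\<lambda>x. x \<noteq> b) xs) \<subset> set ?as" using that(2) by blast
    then show ?thesis by (rule psubset_card_mono[rotated]) simp
  qed
  show ?thesis
  proof (cases "b \<in> set (takeWhile (\<lambda>x. x \<noteq> a) xs)")
    case True
    then show ?thesis using less assms(1) by fastforce
  next
    case False
    obtain ys zs where split: "xs = ys @ a # zs" "a \<notin> set ys"
      using split_list_first[OF assms(1)] by blast
    then have "takeWhile (\<lambda>x. x \<noteq> a) xs = ys" by (auto simp: takeWhile_append)
    with False have "\<forall>x \<in> set ys. x \<noteq> b" by auto
    then have "takeWhile (\<lambda>x. x \<noteq> b) xs = ys @ a # takeWhile (\<lambda>x. x \<noteq> b) zs"
      using assms(3) by (simp add: split(1))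
    then have "a \<in> set (takeWhile (\<lambda>x. x \<noteq> b) xs)" by simp
    then show ?thesis using less assms(2) by fastforce
  qed
qed

lemma nth_pred_image:
  assumes "i \<le> length xs"
  shows "(\<lambda>j. xs ! (j - 1)) ` {1..i} = set (take i xs)"
proof -
  have "{1..i} = Suc ` {0..<i}"
    by (simp only: image_Suc_atLeastLessThan atLeastLessThanSuc_atLeastAtMost One_nat_def)
  then have "(\<lambda>j. xs ! (j - 1)) ` {1..i} = (\<lambda>j. xs ! (j - 1)) ` Suc ` {0..<i}" by simp
  also have "\<dots> = (!) xs ` {0..<i}" by (simp only: image_image diff_Suc_1)
  finally show ?thesis using assms by (simp add: nth_image)
qed

section \<open>Root paths of an elimination ordering\<close>

text \<open>The numeric argument bounds the recursion; \<open>rk v\<close> steps always reach the root.\<close>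

primrec bounded_root_path :: "('v \<Rightarrow> nat) \<Rightarrow> ('v \<Rightarrow> 'v set) \<Rightarrow> nat \<Rightarrow> 'v \<Rightarrow> 'v list" where
  "bounded_root_path rk B 0 v = [v]"
| "bounded_root_path rk B (Suc n) v =
    (if B v = {v} then [v] else bounded_root_path rk B n (peo_parent rk B v) @ [v])"

definition root_path :: "('v \<Rightarrow> nat) \<Rightarrow> ('v \<Rightarrow> 'v set) \<Rightarrow> 'v \<Rightarrow> 'v list" where
  "root_path rk B v = bounded_root_path rk B (rk v) v"

context
  fixes G :: "'v pair_pre_digraph" and rk B t
  assumes G: "pair_graph G" and peo: "peo G rk B t"
begin

private lemmas p = peoD[OF peo]
private lemmas parent = peo_parent[OF pair_graphD(1)[OF G] peo]

text \<open>Every step to the parent lowers the rank, so any bound of at least \<open>rk v\<close>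
  suffices to reach the root.\<close>

lemma bounded_root_path_eq:
  assumes "v \<in> pverts G" "rk v \<le> n" "rk v \<le> m"
  shows "bounded_root_path rk B n v = bounded_root_path rk B m v"
  using assms
proof (induction n arbitrary: m v)
  case 0
  then have "B v = {v}" using parent(3)[of v] by auto
  then show ?case by (cases m) auto
next
  case (Suc n)
  show ?case
  proof (cases "B v = {v}")
    case False
    let ?u = "peo_parent rk B v"
    have u: "?u \<in> pverts G" "rk ?u < rk v" using parent[OF Suc.prems(1) False] by auto
    then obtain m' where m: "m = Suc m'" using Suc.prems(3) by (cases m) auto
    have "bounded_root_path rk B n ?u = bounded_root_path rk B m' ?u"
      using u Suc.prems m by (intro Suc.IH) auto
    then show ?thesis using False by (simp add: m)
  qed (cases m; simp)
qed

lemma root_path_eq: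
  assumes "v \<in> pverts G"
  shows "root_path rk B v = (if B v = {v} then [v] else root_path rk B (peo_parent rk B v) @ [v])"
proof (cases "B v = {v}")
  case True
  then show ?thesis by (cases "rk v") (auto simp: root_path_def)
next
  case False
  note u = parent[OF assms False]
  then obtain n where n: "rk v = Suc n" by (cases "rk v") auto
  then have "bounded_root_path rk B n (peo_parent rk B v) = root_path rk B (peo_parent rk B v)"
    unfolding root_path_def using u by (intro bounded_root_path_eq) auto
  then show ?thesis using False n by (simp add: root_path_def)
qed

text \<open>The clique of \<open>v\<close> without \<open>v\<close> lies in the clique of its
  parent, so by induction the whole clique lies on the path. The last claim, that nonempty initial
  segments are root paths themselves, makes the color of a vertex the same on every path through
  it.\<close>

lemma root_path_props:
  assumes "v \<in> pverts G"
  shows "root_path rk B v \<noteq> []" "last (root_path rk B v) = v" "distinct (root_path rk B v)"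
    and "set (root_path rk B v) \<subseteq> pverts G" "B v \<subseteq> set (root_path rk B v)"
    and "\<forall>w \<in> set (root_path rk B v). rk w \<le> rk v"
    and "\<forall>i < length (root_path rk B v). root_path rk B (root_path rk B v ! i) = take (Suc i) (root_path rk B v)"
proof -
  let ?Q = "\<lambda>v ws. ws \<noteq> [] \<and> last ws = v \<and> distinct ws \<and> set ws \<subseteq> pverts G \<and> B v \<subseteq> set ws \<and>
    (\<forall>w \<in> set ws. rk w \<le> rk v) \<and> (\<forall>i < length ws. root_path rk B (ws ! i) = take (Suc i) ws)"
  have "?Q v (root_path rk B v)" using assms
  proof (induction "rk v" arbitrary: v rule: less_induct)
    case less
    note eq = root_path_eq[OF less.prems]
    show ?case
    proof (cases "B v = {v}")
      case True
      then show ?thesis using eq less.prems by simp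
    next
      case False
      let ?u = "peo_parent rk B v"
      note u = parent[OF less.prems False]
      let ?ws = "root_path rk B ?u"
      have IH: "?Q ?u ?ws" using less.hyps u by blast
      have e: "root_path rk B v = ?ws @ [v]" using eq False by simp
      have "v \<notin> set ?ws" using IH u(3) by force
      moreover have "root_path rk B ((?ws @ [v]) ! i) = take (Suc i) (?ws @ [v])"
        if "i < length (?ws @ [v])" for i
        using that IH e by (cases "i < length ?ws") (auto simp: nth_append less_Suc_eq)
      moreover have "\<forall>w \<in> set ?ws. rk w \<le> rk v" using IH u(3) by force
      moreover have "B v \<subseteq> set (?ws @ [v])" using IH u(4) by auto
      ultimately show ?thesis unfolding e using IH less.prems by auto
    qed
  qed
  then show "root_path rk B v \<noteq> []" "last (root_path rk B v) = v" "distinct (root_path rk B v)"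
    "set (root_path rk B v) \<subseteq> pverts G" "B v \<subseteq> set (root_path rk B v)"
    "\<forall>w \<in> set (root_path rk B v). rk w \<le> rk v"
    "\<forall>i < length (root_path rk B v). root_path rk B (root_path rk B v ! i) = take (Suc i) (root_path rk B v)"
    by blast+
qed

text \<open>Consecutive vertices of a root path are parent and child, so the nesting of cliques in
  \<open>peo_parent\<close> becomes the nesting of bags that a nice sequence asks for.\<close>

lemma root_path_bag:
  assumes v: "v \<in> pverts G" and i: "i < length (root_path rk B v)"
  defines "ws \<equiv> root_path rk B v"
  shows "i = 0 \<Longrightarrow> B (ws ! i) = {ws ! i}" "i > 0 \<Longrightarrow> B (ws ! i) - {ws ! i} \<subseteq> B (ws ! (i - 1))"
proof -
  let ?w = "ws ! i"
  have w: "?w \<in> pverts G" using root_path_props(4)[OF v] i by (auto simp: ws_def)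
  have take: "root_path rk B ?w = take (Suc i) ws" using root_path_props(7)[OF v] i by (simp add: ws_def)
  have len: "length (root_path rk B ?w) = Suc i" unfolding take using i by (simp add: ws_def)
  show "B ?w = {?w}" if "i = 0"
  proof (rule ccontr)
    assume ne: "B ?w \<noteq> {?w}"
    then have "root_path rk B (peo_parent rk B ?w) = []"
      using root_path_eq[OF w] len that by simp
    then show False using root_path_props(1) parent(1)[OF w ne] by blast
  qed
  show "B ?w - {?w} \<subseteq> B (ws ! (i - 1))" if "i > 0"
  proof -
    have ne: "B ?w \<noteq> {?w}" using root_path_eq[OF w] len that by auto
    have "take (Suc i) ws = take i ws @ [?w]" using i by (simp add: take_Suc_conv_app_nth ws_def)
    then have "root_path rk B (peo_parent rk B ?w) = take i ws"
      using root_path_eq[OF w] ne take by simp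
    then have "last (take i ws) = peo_parent rk B ?w"
      using root_path_props(2)[OF parent(1)[OF w ne]] by simp
    moreover have "last (take i ws) = ws ! (i - 1)"
      using that i by (subst last_conv_nth) (auto simp: ws_def)
    ultimately show ?thesis using parent(4)[OF w ne] by simp
  qed
qed

section \<open>The decomposed graph on a root path\<close>

context
  fixes e :: "nat \<Rightarrow> 'n"
  assumes e: "inj e"
begin

text \<open>
  Nodes are numbered by their position on the path rather than by the vertices they introduce, so
  that root paths sharing an initial segment yield identical prefixes.
\<close>

definition bag_of :: "'v list \<Rightarrow> 'n \<Rightarrow> 'v set" where
  "bag_of ws = restrict (\<lambda>z. case inv e z of 0 \<Rightarrow> {} | Suc i \<Rightarrow> B (ws ! i)) (e ` {..length ws})"

definition path_triple :: "'v list \<Rightarrow> ('v, 'n) decomposed_graph" where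
  "path_triple ws = (induced G (set ws), map e [0..<Suc (length ws)], bag_of ws)"

private lemma bag_of_simps:
  "bag_of ws (e 0) = {}" "i < length ws \<Longrightarrow> bag_of ws (e (Suc i)) = B (ws ! i)"
  using e by (auto simp: bag_of_def)

private lemma nth_nodes: "i \<le> length ws \<Longrightarrow> map e [0..<Suc (length ws)] ! i = e i"
  by (simp add: nth_append del: upt_Suc)

text \<open>Indices are shifted by one: position 0 carries the empty bag, and position
  \<open>j\<close> introduces \<open>ws ! (j - 1)\<close>.\<close>

lemma root_path_nice_sequence:
  assumes v: "v \<in> pverts G"
  defines "ws \<equiv> root_path rk B v"
  shows "nice_sequence (induced G (set ws)) (map e [0..<Suc (length ws)]) (bag_of ws) (\<lambda>j. ws ! (j - 1))"
proof -
  let ?P = "map e [0..<Suc (length ws)]" and ?n = "length ws"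
  note r = root_path_props[OF v, folded ws_def]
  have P: "?P \<noteq> []" "distinct ?P" "length ?P - 1 = ?n"
    using e by (auto simp: distinct_map intro: inj_on_subset simp del: upt_Suc)
  have bag: "bag_of ws (?P ! j) = B (ws ! (j - 1))" if "j \<in> {1..?n}" for j
    using that nth_nodes[of j ws] bag_of_simps(2)[of "j - 1" ws] by auto
  have bag0: "bag_of ws (?P ! 0) = {}" using nth_nodes[of 0 ws] bag_of_simps(1) by simp
  have "inj_on (\<lambda>j. ws ! (j - 1)) {1..?n}"
    using r(3) by (auto intro!: inj_onI simp: nth_eq_iff_index_eq)
  moreover have "set ws = (\<lambda>j. ws ! (j - 1)) ` {1..?n}" using nth_pred_image[of ?n ws] by simp
  moreover have "ws ! (j - 1) \<in> B (ws ! (j - 1))" if "j \<in> {1..?n}" for j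
  proof -
    have "ws ! (j - 1) \<in> set ws" using that by (intro nth_mem) auto
    then show ?thesis using r(4) p(2) by blast
  qed
  moreover have "B (ws ! (j - 1)) - {ws ! (j - 1)} \<subseteq> bag_of ws (?P ! (j - 1))" if j: "j \<in> {1..?n}" for j
  proof (cases "j = 1")
    case True
    then have "B (ws ! (j - 1)) = {ws ! (j - 1)}" using root_path_bag(1)[OF v, of 0] True r(1) by (simp add: ws_def)
    then show ?thesis by simp
  next
    case False
    then have "j - 1 < ?n" "j - 1 > 0" "j - 1 \<in> {1..?n}" using j by auto
    then show ?thesis
      using root_path_bag(2)[OF v, of "j - 1"] bag[of "j - 1"] by (simp add: ws_def del: upt_Suc)
  qed
  \<comment> \<open>Ranks increase along the path, so the later end of an arc cannot lie in the
    clique of the earlier one; the elimination ordering must place the earlier end in the clique of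
    the later.\<close>
  moreover have "ws ! (i - 1) \<in> B (ws ! (j - 1))"
    if ij: "i \<in> {1..?n}" "j \<in> {1..?n}" "i < j" and arc: "(ws ! (i - 1), ws ! (j - 1)) \<in> parcs (induced G (set ws))" for i j
  proof -
    let ?u = "ws ! (i - 1)" and ?w = "ws ! (j - 1)"
    have "?u \<in> set ws" "?w \<in> set ws" using arc by auto
    then have V: "?u \<in> pverts G" "?w \<in> pverts G" using r(4) by auto
    have "root_path rk B ?w = take j ws" using r(7) ij by auto
    moreover have "?u \<in> set (take j ws)" using ij by (auto simp: in_set_conv_nth intro!: exI[of _ "i - 1"])
    ultimately have "rk ?u \<le> rk ?w" using root_path_props(6)[OF V(2)] by simp
    moreover have "?u \<noteq> ?w" using r(3) ij by (auto simp: nth_eq_iff_index_eq)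
    then have "rk ?u \<noteq> rk ?w" using V p(1) by (meson inj_onD)
    ultimately have "?w \<notin> B ?u" using p(5)[OF V(1), of ?w] by auto
    then show ?thesis using p(7)[of ?u ?w] arc by auto
  qed
  ultimately show ?thesis
    unfolding nice_sequence_def P(3) using P(1,2) bag bag0 by simp
qed

text \<open>The input at position \<open>i\<close> depends only on the first \<open>i\<close>
  vertices of the path, so an on-line color is a function of the root path of its vertex.\<close>

lemma decomposition_prefix_path_triple:
  assumes v: "v \<in> pverts G" and i: "i \<le> length (root_path rk B v)"
  defines "ws \<equiv> root_path rk B v"
  shows "decomposition_prefix (induced G (set ws)) (map e [0..<Suc (length ws)]) (bag_of ws) i =
    path_triple (take i ws)"
proof -
  let ?P = "map e [0..<Suc (length ws)]"
  have i': "i \<le> length ws" using i by (simp add: ws_def)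
  have "set ws \<subseteq> pverts G" using root_path_props(4)[OF v] by (simp add: ws_def)
  then have "pair_graph (induced G (set ws))" by (rule pair_graph_induced[OF G])
  then have "decomposition_prefix (induced G (set ws)) ?P (bag_of ws) i =
    (induced (induced G (set ws)) ((\<lambda>j. ws ! (j - 1)) ` {1..i}), take (Suc i) ?P,
      restrict (bag_of ws) (set (take (Suc i) ?P)))"
    using root_path_nice_sequence[OF v] i' unfolding ws_def by (intro decomposition_prefix_eq) auto
  moreover have "(\<lambda>j. ws ! (j - 1)) ` {1..i} = set (take i ws)" by (rule nth_pred_image[OF i'])
  moreover have "induced (induced G (set ws)) (set (take i ws)) = induced G (set (take i ws))"
    using set_take_subset[of i ws] by (auto simp: induced_def)
  moreover have take: "take (Suc i) ?P = map e [0..<Suc i]"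
    using i' by (simp add: take_map del: upt_Suc)
  moreover have "restrict (bag_of ws) (e ` {0..<Suc i}) = bag_of (take i ws)"
    using i' e by (auto simp: bag_of_def restrict_def fun_eq_iff min_def split: nat.splits)
  moreover have "length (take i ws) = i" using i' by simp
  ultimately show ?thesis by (simp add: path_triple_def del: upt_Suc length_take)
qed

lemma chromatic_number_le_online:
  fixes A' :: "('v, 'n) decomposed_graph \<Rightarrow> int"
  assumes free: "clique_free k G" and online: "online_coloring_algorithm A'"
    and bound: "\<And>H P \<beta>. pair_graph H \<Longrightarrow> clique_free k H \<Longrightarrow> nice_path_decomposition H P \<beta> \<Longrightarrow>
      decomposition_width (path_graph P) \<beta> \<le> int t \<Longrightarrow> online_chromatic_number A' H P \<beta> \<le> c'"
  shows "chromatic_number G \<le> c'"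
proof -
  let ?\<pi> = "root_path rk B"
  \<comment> \<open>The color that \<open>v\<close> receives at the end of its own root path; by the
    prefix property it is also its color on every longer path.\<close>
  define raw where "raw v = A' (path_triple (?\<pi> v))" for v
  have raw_path: "proper_coloring (induced G (set (?\<pi> v))) raw \<and> card (raw ` set (?\<pi> v)) \<le> c'"
    if v: "v \<in> pverts G" for v
  proof -
    define ws where "ws = ?\<pi> v"
    let ?H = "induced G (set ws)" and ?P = "map e [0..<Suc (length ws)]"
    note r = root_path_props[OF v, folded ws_def]
    have H: "pair_graph ?H" by (rule pair_graph_induced[OF G r(4)])
    have seq: "nice_sequence ?H ?P (bag_of ws) (\<lambda>j. ws ! (j - 1))"
      using root_path_nice_sequence[OF v] by (simp add: ws_def)
    have nice: "nice_path_decomposition ?H ?P (bag_of ws)"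
      by (rule nice_path_decomposition_if_sequence[OF H seq])
    have "card (bag_of ws (?P ! j)) \<le> Suc t" if "j < length ?P" for j
    proof (cases j)
      case 0
      then show ?thesis using nth_nodes[of 0 ws] bag_of_simps(1)[of ws] by simp
    next
      case (Suc i)
      then have "i < length ws" using that by simp
      moreover from this have "ws ! i \<in> pverts G" using r(4) by auto
      ultimately show ?thesis
        using nth_nodes[of j ws] bag_of_simps(2)[of i ws] p(4) Suc by simp
    qed
    then have "decomposition_width (path_graph ?P) (bag_of ws) \<le> int t"
      by (subst path_graph_width_le_iff) auto
    then have colors: "online_chromatic_number A' ?H ?P (bag_of ws) \<le> c'"
      using bound[OF H clique_free_induced[OF G r(4) free] nice] by simp
    have proper: "proper_coloring ?H (produced_coloring A' ?H ?P (bag_of ws))"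
      using online H nice r(1) unfolding online_coloring_algorithm_def
      by (auto simp: Suc_le_eq simp del: upt_Suc)
    have eq: "produced_coloring A' ?H ?P (bag_of ws) u = raw u" if u: "u \<in> set ws" for u
    proof -
      obtain i where i: "i < length ws" "u = ws ! i" using u by (auto simp: in_set_conv_nth)
      have "produced_coloring A' ?H ?P (bag_of ws) (ws ! (Suc i - 1)) =
        A' (decomposition_prefix ?H ?P (bag_of ws) (Suc i))"
        using i(1) by (intro produced_coloring_eq[OF seq]) auto
      also have "\<dots> = A' (path_triple (take (Suc i) ws))"
        using decomposition_prefix_path_triple[OF v, of "Suc i"] i(1) by (simp add: ws_def)
      also have "\<dots> = raw u" using r(7) i by (simp add: raw_def)
      finally show ?thesis using i(2) by simp
    qed
    have "proper_coloring ?H raw"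
      unfolding proper_coloring_def
    proof (clarify)
      fix a b assume ab: "(a, b) \<in> parcs ?H" "raw a = raw b"
      then have "produced_coloring A' ?H ?P (bag_of ws) a \<noteq> produced_coloring A' ?H ?P (bag_of ws) b"
        using proper unfolding proper_coloring_def by blast
      then show False using ab eq by (simp del: upt_Suc)
    qed
    moreover have "card (raw ` set ws) \<le> c'"
      using colors eq unfolding online_chromatic_number_def num_colors_def by (simp cong: image_cong)
    ultimately show ?thesis by (simp add: ws_def)
  qed
  define idx where "idx v = card (set (takeWhile (\<lambda>x. x \<noteq> raw v) (map raw (?\<pi> v))))" for v
  have v_mem: "v \<in> set (?\<pi> v)" if "v \<in> pverts G" for v
    using root_path_props(1,2)[OF that] last_in_set by metis
  \<comment> \<open>The count never includes the raw color of \<open>v\<close> itself, so it stays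
    strictly below the number of raw colors on the path.\<close>
  have lt: "idx v < c'" if v: "v \<in> pverts G" for v
  proof -
    have "set (takeWhile (\<lambda>x. x \<noteq> raw v) (map raw (?\<pi> v))) \<subseteq> raw ` set (?\<pi> v) - {raw v}"
      by (auto dest: set_takeWhileD)
    then have "set (takeWhile (\<lambda>x. x \<noteq> raw v) (map raw (?\<pi> v))) \<subset> raw ` set (?\<pi> v)"
      using v_mem[OF v] by blast
    then have "idx v < card (raw ` set (?\<pi> v))" unfolding idx_def by (intro psubset_card_mono) auto
    then show ?thesis using raw_path[OF v] by simp
  qed
  \<comment> \<open>Both counts can be made on the path of \<open>v\<close>: the path of
    \<open>u\<close> is an initial segment that already contains the color of \<open>u\<close>, so
    the first occurrence of that color is the same on both.\<close>
  have neq: "idx u \<noteq> idx v" if u: "u \<in> B v" "u \<noteq> v" "(u, v) \<in> parcs G" for u v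
  proof -
    have v: "v \<in> pverts G" using u(3) pair_graphD(2)[OF G] by auto
    have mem: "u \<in> set (?\<pi> v)" "v \<in> set (?\<pi> v)" using root_path_props(5)[OF v] u(1) v_mem[OF v] by auto
    then have "raw u \<noteq> raw v" using raw_path[OF v] u(3) by (auto simp: proper_coloring_def)
    then have "card (set (takeWhile (\<lambda>x. x \<noteq> raw u) (map raw (?\<pi> v)))) \<noteq> idx v"
      unfolding idx_def using mem by (intro card_takeWhile_neq) auto
    moreover have "takeWhile (\<lambda>x. x \<noteq> raw u) (map raw (?\<pi> v)) = takeWhile (\<lambda>x. x \<noteq> raw u) (map raw (?\<pi> u))"
    proof -
      obtain i where i: "i < length (?\<pi> v)" "u = ?\<pi> v ! i" using mem(1) by (auto simp: in_set_conv_nth)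
      then have "?\<pi> v = ?\<pi> u @ drop (Suc i) (?\<pi> v)" using root_path_props(7)[OF v] by simp
      then have "map raw (?\<pi> v) = map raw (?\<pi> u) @ map raw (drop (Suc i) (?\<pi> v))"
        by (metis map_append)
      moreover have "raw u \<in> set (map raw (?\<pi> u))"
        using v_mem[of u] u(3) pair_graphD(2)[OF G] by auto
      ultimately show ?thesis by (simp only: takeWhile_append1)
    qed
    ultimately show ?thesis unfolding idx_def by simp
  qed
  have "proper_coloring G (\<lambda>v. int (idx v))"
    unfolding proper_coloring_def
  proof (clarify)
    fix u v assume uv: "(u, v) \<in> parcs G" "int (idx u) = int (idx v)"
    have "(v, u) \<in> parcs G" "u \<noteq> v" using uv(1) pair_graphD(3,4)[OF G] by auto
    then show False using p(7)[OF uv(1)] neq uv by (metis of_nat_eq_iff)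
  qed
  then have "chromatic_number G \<le> num_colors G (\<lambda>v. int (idx v))" by (rule chromatic_number_le)
  also have "\<dots> \<le> card {0..<int c'}"
    unfolding num_colors_def using lt by (intro card_mono) auto
  finally show ?thesis by simp
qed

end

end

section \<open>An optimal on-line algorithm\<close>

text \<open>The theorem of de Bruijn and Erdos; the colorings form a compact product space.\<close>

lemma coloring_compactness:
  fixes E :: "('a \<times> 'a) set" and c :: nat
  assumes fin: "\<And>F. finite F \<Longrightarrow> F \<subseteq> W \<Longrightarrow>
    \<exists>\<phi>. (\<forall>x \<in> F. \<phi> x < c) \<and> (\<forall>x \<in> F. \<forall>y \<in> F. (x, y) \<in> E \<longrightarrow> \<phi> x \<noteq> \<phi> y)"
  shows "\<exists>\<phi>. (\<forall>x \<in> W. \<phi> x < c) \<and> (\<forall>x \<in> W. \<forall>y \<in> W. (x, y) \<in> E \<longrightarrow> \<phi> x \<noteq> \<phi> y)"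
proof -
  define X where "X = product_topology (\<lambda>_. discrete_topology {..<c}) W"
  define C where "C e = {\<phi> \<in> topspace X. \<phi> (fst e) \<noteq> \<phi> (snd e)}" for e
  let ?E = "Restr E W"
  have top: "topspace X = (\<Pi>\<^sub>E x\<in>W. {..<c})" by (simp add: X_def)
  have compact: "compact_space X"
    unfolding X_def compact_space_product_topology by (simp add: compact_space_discrete_topology)
  \<comment> \<open>A constraint looks at two coordinates only and splits into finitely many closed
    sets, one for each color of \<open>x\<close>. The full space belongs to the family so that a
    common point is a coloring even if there are no arcs.\<close>
  have closed: "closedin X S" if S: "S \<in> insert (topspace X) (C ` ?E)" for S
  proof (cases "S = topspace X")
    case False
    then obtain x y where xy: "x \<in> W" "y \<in> W" "S = C (x, y)" using S by auto
    have pre: "closedin X {\<phi> \<in> topspace X. \<phi> z \<in> A}" if "z \<in> W" "A \<subseteq> {..<c}" for z A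
    proof (rule closedin_continuous_map_preimage)
      show "continuous_map X (discrete_topology {..<c}) (\<lambda>\<phi>. \<phi> z)"
        unfolding X_def by (rule continuous_map_product_projection[OF that(1)])
      show "closedin (discrete_topology {..<c}) A" using that(2) by simp
    qed
    have "S = (\<Union>a<c. {\<phi> \<in> topspace X. \<phi> x \<in> {a}} \<inter> {\<phi> \<in> topspace X. \<phi> y \<in> {..<c} - {a}})"
      using xy by (auto simp: C_def top PiE_iff)
    also have "closedin X \<dots>"
    proof (rule closedin_Union)
      fix T assume "T \<in> (\<lambda>a. {\<phi> \<in> topspace X. \<phi> x \<in> {a}} \<inter> {\<phi> \<in> topspace X. \<phi> y \<in> {..<c} - {a}}) ` {..<c}"
      then obtain a where a: "a < c"
        "T = {\<phi> \<in> topspace X. \<phi> x \<in> {a}} \<inter> {\<phi> \<in> topspace X. \<phi> y \<in> {..<c} - {a}}" by blast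
      show "closedin X T" unfolding a(2) by (intro closedin_Int pre xy) (use a(1) in auto)
    qed simp
    finally show ?thesis .
  qed simp
  have fip: "\<Inter>\<F> \<noteq> {}" if F: "finite \<F>" "\<F> \<subseteq> insert (topspace X) (C ` ?E)" for \<F>
  proof -
    have "finite (\<F> - {topspace X})" "\<F> - {topspace X} \<subseteq> C ` ?E" using F by auto
    from finite_subset_image[OF this] obtain D where D: "D \<subseteq> ?E" "finite D" "\<F> - {topspace X} = C ` D"
      by blast
    \<comment> \<open>Finitely many constraints involve only finitely many vertices. All others get
      color 0, which is available because any single vertex of \<open>W\<close> can be
      colored.\<close>
    define U where "U = fst ` D \<union> snd ` D"
    have U: "finite U" "U \<subseteq> W" using D by (auto simp: U_def)
    from fin[OF this] obtain \<phi> where \<phi>: "\<And>x. x \<in> U \<Longrightarrow> \<phi> x < c"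
      "\<And>x y. x \<in> U \<Longrightarrow> y \<in> U \<Longrightarrow> (x, y) \<in> E \<Longrightarrow> \<phi> x \<noteq> \<phi> y" by blast
    have "0 < c" if "x \<in> W" for x using fin[of "{x}"] that by auto
    then have in_top: "(\<lambda>x \<in> W. if x \<in> U then \<phi> x else 0) \<in> topspace X"
      using \<phi>(1) by (auto simp: top)
    have "(\<lambda>x \<in> W. if x \<in> U then \<phi> x else 0) \<in> S" if S: "S \<in> \<F>" for S
    proof (cases "S = topspace X")
      case False
      then obtain d where d: "d \<in> D" "S = C d" using S D(3) by blast
      have "fst d \<in> U" "snd d \<in> U" "d \<in> E" using d(1) D(1) by (auto simp: U_def)
      then show ?thesis using \<phi>(2)[of "fst d" "snd d"] in_top U(2) unfolding d(2) C_def by auto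
    qed (use in_top in simp)
    then show ?thesis by blast
  qed
  have "\<Inter>(insert (topspace X) (C ` ?E)) \<noteq> {}"
    using closed fip by (intro compact_space_fip[THEN iffD1, rule_format, OF compact] conjI) simp_all
  then obtain \<phi> where \<phi>: "\<phi> \<in> topspace X" "\<And>e. e \<in> ?E \<Longrightarrow> \<phi> \<in> C e" by blast
  have "\<phi> x < c" if "x \<in> W" for x using \<phi>(1) that by (auto simp: top)
  moreover have "\<phi> x \<noteq> \<phi> y" if "x \<in> W" "y \<in> W" "(x, y) \<in> E" for x y
    using \<phi>(2)[of "(x, y)"] that by (simp add: C_def)
  ultimately show ?thesis by blast
qed

lemma injection_into_infinite:
  assumes "finite (V :: 'a set)"
  obtains g :: "'a \<Rightarrow> 'v::infinite" where "inj_on g V"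
proof -
  obtain f :: "'a \<Rightarrow> nat" where f: "inj_on f V" using finite_imp_inj_to_nat_seg[OF assms] by blast
  obtain h :: "nat \<Rightarrow> 'v" where "inj h"
    using infinite_countable_subset[OF infinite_UNIV] by blast
  then have "inj_on (h \<circ> f) V" using f by (intro comp_inj_on) (auto intro: inj_on_subset)
  then show ?thesis using that by blast
qed

text \<open>The maximum \<open>c\<close> concerns graphs on \<open>'v\<close>. A finite graph on
  another type is copied into \<open>'v\<close> along an injection, together with its elimination
  ordering, and the coloring is pulled back.\<close>

lemma peo_max_coloring:
  fixes G :: "'a pair_pre_digraph"
  assumes G: "pair_graph G" and free: "clique_free k G" and peo: "peo G rk B t"
    and c: "c = max_chromatic_number TYPE('v::infinite) t k"
  obtains \<phi> :: "'a \<Rightarrow> nat" where "\<And>x. x \<in> pverts G \<Longrightarrow> \<phi> x < c"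
    and "\<And>x y. (x, y) \<in> parcs G \<Longrightarrow> \<phi> x \<noteq> \<phi> y"
proof -
  let ?V = "pverts G" and ?E = "parcs G"
  note g = pair_graphD[OF G] and p = peoD[OF peo]
  obtain g :: "'a \<Rightarrow> 'v" where inj: "inj_on g ?V" using injection_into_infinite[OF g(1)] by blast
  define h where "h = inv_into ?V g"
  have h: "h (g x) = x" if "x \<in> ?V" for x using that inj by (simp add: h_def)
  define G' where "G' = \<lparr>pverts = g ` ?V, parcs = map_prod g g ` ?E\<rparr>"
  have arc_iff: "(g x, g y) \<in> parcs G' \<longleftrightarrow> (x, y) \<in> ?E" if "x \<in> ?V" "y \<in> ?V" for x y
  proof
    assume "(g x, g y) \<in> parcs G'"
    then obtain a b where ab: "(a, b) \<in> ?E" "g x = g a" "g y = g b" by (auto simp: G'_def)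
    then have "a = x" "b = y" using inj that g(2) by (auto dest: inj_onD)
    then show "(x, y) \<in> ?E" using ab(1) by simp
  qed (auto simp: G'_def intro: rev_image_eqI)
  have G': "pair_graph G'"
  proof (rule pair_graphI)
    show "(v, u) \<in> parcs G'" if "(u, v) \<in> parcs G'" for u v
      using that g(3) by (force simp: G'_def)
    show "(u, u) \<notin> parcs G'" for u
    proof
      assume u: "(u, u) \<in> parcs G'"
      then obtain a where "a \<in> ?V" "u = g a" using g(2) by (auto simp: G'_def)
      then show False using u arc_iff g(4) by simp
    qed
  qed (use g in \<open>auto simp: G'_def\<close>)
  have "clique_free k G'"
    unfolding clique_free_iff[OF G']
  proof
    assume "\<exists>X \<subseteq> pverts G'. card X = k \<and> (\<forall>u \<in> X. \<forall>v \<in> X. u \<noteq> v \<longrightarrow> (u, v) \<in> parcs G')"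
    then obtain X where X: "X \<subseteq> g ` ?V" "card X = k"
      "\<And>u v. u \<in> X \<Longrightarrow> v \<in> X \<Longrightarrow> u \<noteq> v \<Longrightarrow> (u, v) \<in> parcs G'" by (auto simp: G'_def)
    obtain Y where Y: "Y \<subseteq> ?V" "X = g ` Y" using X(1) by (auto elim: subset_imageE)
    have injY: "inj_on g Y" using inj Y(1) by (rule inj_on_subset)
    have "card Y = k" using X(2) Y(2) card_image[OF injY] by simp
    moreover have "(u, v) \<in> ?E" if "u \<in> Y" "v \<in> Y" "u \<noteq> v" for u v
    proof -
      have "g u \<noteq> g v" using injY that by (meson inj_onD)
      then have "(g u, g v) \<in> parcs G'" using X(3) Y(2) that by blast
      then show ?thesis using arc_iff Y(1) that by blast
    qed
    ultimately show False using free Y(1) unfolding clique_free_iff[OF G] by blast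
  qed
  moreover have "peo G' (rk \<circ> h) (\<lambda>v. g ` B (h v)) t"
    unfolding peo_def
  proof (intro conjI ballI impI)
    show "inj_on (rk \<circ> h) (pverts G')"
      using p(1) by (auto simp: G'_def inj_on_def h)
    fix v assume "v \<in> pverts G'"
    then obtain x where x: "x \<in> ?V" "v = g x" by (auto simp: G'_def)
    note px = p(2-6)[OF x(1)]
    have hB: "h ` g ` B x = B x" using px(2) h by force
    show "v \<in> g ` B (h v)" "g ` B (h v) \<subseteq> pverts G'" using px(1,2) x by (auto simp: h G'_def)
    have "finite (B x)" using px(2) g(1) finite_subset by blast
    then show "card (g ` B (h v)) \<le> Suc t" using px(3) card_image_le[of "B x" g] x by (simp add: h)
    fix w assume "w \<in> g ` B (h v)"
    then obtain y where y: "y \<in> B x" "y \<in> ?V" "w = g y" using x px(2) by (auto simp: h)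
    show "(rk \<circ> h) w \<le> (rk \<circ> h) v" using y x px(4) by (simp add: h)
    fix u assume "u \<in> g ` B (h v)" "(rk \<circ> h) w \<le> (rk \<circ> h) u"
    then obtain z where z: "z \<in> B x" "z \<in> ?V" "u = g z" using x px(2) by (auto simp: h)
    then have "y \<in> B z" using px(5)[OF y(1) z(1)] \<open>(rk \<circ> h) w \<le> (rk \<circ> h) u\<close> y by (simp add: h)
    then show "w \<in> g ` B (h u)" using y z by (simp add: h)
  next
    fix e assume "e \<in> parcs G'"
    then obtain x y where xy: "(x, y) \<in> ?E" "e = (g x, g y)" by (auto simp: G'_def)
    then have "x \<in> ?V" "y \<in> ?V" using g(2) by auto
    then show "case e of (u, v) \<Rightarrow> u \<in> g ` B (h v) \<or> v \<in> g ` B (h u)"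
      using p(7)[OF xy(1)] xy(2) by (auto simp: h)
  qed
  then have "tree_width G' \<le> int t" using tree_width_le_iff_peo[OF G'] by blast
  ultimately have le: "chromatic_number G' \<le> c" unfolding c by (intro chromatic_number_le_max G')
  obtain \<psi> where \<psi>: "proper_coloring G' \<psi>" "num_colors G' \<psi> = chromatic_number G'"
    using chromatic_number_attained[OF G'] .
  \<comment> \<open>An optimal coloring uses arbitrary integers; numbering its colors gives values
    below \<open>c\<close>.\<close>
  have "finite (\<psi> ` pverts G')" using pair_graphD(1)[OF G'] by simp
  from finite_imp_inj_to_nat_seg[OF this] obtain f :: "int \<Rightarrow> nat" and n where
    f: "f ` \<psi> ` pverts G' = {i. i < n}" "inj_on f (\<psi> ` pverts G')" by blast
  have "n = card (f ` \<psi> ` pverts G')" unfolding f(1) by simp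
  also have "\<dots> \<le> c" using \<psi>(2) le by (simp add: card_image[OF f(2)] num_colors_def)
  finally have n: "n \<le> c" .
  have "f (\<psi> (g x)) < c" if "x \<in> ?V" for x
  proof -
    have "f (\<psi> (g x)) \<in> f ` \<psi> ` pverts G'" using that by (auto simp: G'_def)
    then show ?thesis using f(1) n by auto
  qed
  moreover have "f (\<psi> (g x)) \<noteq> f (\<psi> (g y))" if xy: "(x, y) \<in> ?E" for x y
  proof -
    have V: "x \<in> ?V" "y \<in> ?V" using xy g(2) by auto
    then have "\<psi> (g x) \<noteq> \<psi> (g y)" using \<psi>(1) arc_iff xy unfolding proper_coloring_def by blast
    moreover have "\<psi> (g x) \<in> \<psi> ` pverts G'" "\<psi> (g y) \<in> \<psi> ` pverts G'" using V by (auto simp: G'_def)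
    ultimately show ?thesis using f(2) by (meson inj_onD)
  qed
  ultimately show ?thesis using that[of "\<lambda>x. f (\<psi> (g x))"] by blast
qed

section \<open>Inputs and their prefixes\<close>

definition last_index :: "('v, 'n) decomposed_graph \<Rightarrow> nat" where
  "last_index x = length (fst (snd x)) - 1"

definition prefix_at :: "('v, 'n) decomposed_graph \<Rightarrow> nat \<Rightarrow> ('v, 'n) decomposed_graph" where
  "prefix_at x = decomposition_prefix (fst x) (fst (snd x)) (snd (snd x))"

definition vertex_at :: "('v, 'n) decomposed_graph \<Rightarrow> nat \<Rightarrow> 'v" where
  "vertex_at x = introduced (fst (snd x)) (snd (snd x))"

definition bag_at :: "('v, 'n) decomposed_graph \<Rightarrow> nat \<Rightarrow> 'v set" where
  "bag_at x j = snd (snd x) (fst (snd x) ! j)"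

text \<open>Extensionality makes an input equal to its own full prefix.\<close>

definition admissible :: "nat \<Rightarrow> nat \<Rightarrow> ('v, 'n) decomposed_graph \<Rightarrow> bool" where
  "admissible k t x \<longleftrightarrow> (case x of (G, P, \<beta>) \<Rightarrow>
    pair_graph G \<and> clique_free k G \<and> nice_path_decomposition G P \<beta> \<and>
    decomposition_width (path_graph P) \<beta> \<le> int t \<and> 2 \<le> length P \<and> \<beta> \<in> extensional (set P))"

lemma decomposition_prefix_selectors:
  assumes G: "pair_graph G" and s: "nice_sequence G P \<beta> v" and j: "j < length P"
  shows "last_index (decomposition_prefix G P \<beta> j) = j"
    and "fst (decomposition_prefix G P \<beta> j) = induced G (v ` {1..j})"
    and "1 \<le> i \<Longrightarrow> i \<le> j \<Longrightarrow> vertex_at (decomposition_prefix G P \<beta> j) i = v i"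
    and "i \<le> j \<Longrightarrow> bag_at (decomposition_prefix G P \<beta> j) i = \<beta> (P ! i)"
    and "i \<le> j \<Longrightarrow> prefix_at (decomposition_prefix G P \<beta> j) i = decomposition_prefix G P \<beta> i"
proof -
  note eq = decomposition_prefix_eq[OF G s j]
  note seq = nice_sequence_prefix[OF s j]
  show "last_index (decomposition_prefix G P \<beta> j) = j"
    "fst (decomposition_prefix G P \<beta> j) = induced G (v ` {1..j})"
    using j by (simp_all add: eq last_index_def)
  show "vertex_at (decomposition_prefix G P \<beta> j) i = v i" if "1 \<le> i" "i \<le> j"
    using nice_sequence_introduced[OF seq that(1)] that(2) j by (simp add: eq vertex_at_def)
  show "bag_at (decomposition_prefix G P \<beta> j) i = \<beta> (P ! i)" if "i \<le> j"
  proof -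
    have "take (Suc j) P ! i \<in> set (take (Suc j) P)" using that j by (intro nth_mem) simp
    then show ?thesis using that by (simp add: eq bag_at_def)
  qed
  show "prefix_at (decomposition_prefix G P \<beta> j) i = decomposition_prefix G P \<beta> i" if "i \<le> j"
    using decomposition_prefix_prefix[OF G s that j] by (simp add: prefix_at_def split_beta)
qed

lemma admissible_decomposition_prefix:
  assumes G: "pair_graph G" "clique_free k G" and s: "nice_sequence G P \<beta> v"
    and width: "decomposition_width (path_graph P) \<beta> \<le> int t" and j: "1 \<le> j" "j < length P"
  shows "admissible k t (decomposition_prefix G P \<beta> j)"
proof -
  have sub: "v ` {1..j} \<subseteq> pverts G" using nice_sequenceD(5)[OF s] j by auto
  note H = pair_graph_induced[OF G(1) sub]
  have P: "P \<noteq> []" using j by auto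
  have "decomposition_width (path_graph (take (Suc j) P)) (restrict \<beta> (set (take (Suc j) P))) \<le> int t"
  proof (subst path_graph_width_le_iff)
    show "take (Suc j) P \<noteq> []" using P by simp
    show "\<forall>i < length (take (Suc j) P). card (restrict \<beta> (set (take (Suc j) P)) (take (Suc j) P ! i)) \<le> Suc t"
    proof (intro allI impI)
      fix i assume i: "i < length (take (Suc j) P)"
      then have "take (Suc j) P ! i \<in> set (take (Suc j) P)" by (rule nth_mem)
      then show "card (restrict \<beta> (set (take (Suc j) P)) (take (Suc j) P ! i)) \<le> Suc t"
        using width i unfolding path_graph_width_le_iff[OF P] by simp
    qed
  qed
  then show ?thesis
    unfolding decomposition_prefix_eq[OF G(1) s j(2)] admissible_def
    using H clique_free_induced[OF G(1) sub G(2)] j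
      nice_path_decomposition_if_sequence[OF H nice_sequence_prefix[OF s j(2)]]
    by simp
qed

lemma admissibleD:
  assumes x: "admissible k t x"
  shows "pair_graph (fst x)" "clique_free k (fst x)"
    and "nice_sequence (fst x) (fst (snd x)) (snd (snd x)) (vertex_at x)"
    and "1 \<le> last_index x" "length (fst (snd x)) = Suc (last_index x)"
    and "prefix_at x (last_index x) = x"
    and "j \<le> last_index x \<Longrightarrow> card (bag_at x j) \<le> Suc t"
    and "1 \<le> j \<Longrightarrow> j \<le> last_index x \<Longrightarrow> admissible k t (prefix_at x j)"
proof -
  obtain G P \<beta> where eq: "x = (G, P, \<beta>)" by (cases x)
  have G: "pair_graph G" "clique_free k G" and nice: "nice_path_decomposition G P \<beta>"
    and width: "decomposition_width (path_graph P) \<beta> \<le> int t" and len: "2 \<le> length P"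
    and ext: "\<beta> \<in> extensional (set P)"
    using x by (auto simp: eq admissible_def)
  have s: "nice_sequence G P \<beta> (introduced P \<beta>)" by (rule nice_path_decomposition_sequence[OF G(1) nice])
  show "pair_graph (fst x)" "clique_free k (fst x)"
    "nice_sequence (fst x) (fst (snd x)) (snd (snd x)) (vertex_at x)"
    "1 \<le> last_index x" "length (fst (snd x)) = Suc (last_index x)"
    using G s len by (simp_all add: eq vertex_at_def last_index_def)
  show "prefix_at x (last_index x) = x"
    using decomposition_prefix_full[OF G(1) s] extensional_restrict[OF ext]
    by (simp add: eq prefix_at_def last_index_def)
  have P: "P \<noteq> []" using len by auto
  show "card (bag_at x j) \<le> Suc t" if "j \<le> last_index x"
    using width that len unfolding path_graph_width_le_iff[OF P] by (auto simp: eq bag_at_def last_index_def)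
  show "admissible k t (prefix_at x j)" if "1 \<le> j" "j \<le> last_index x"
    using admissible_decomposition_prefix[OF G s width that(1)] that len
    by (simp add: eq prefix_at_def last_index_def)
qed

lemma prefix_at_selectors:
  assumes x: "admissible k t x" and j: "j \<le> last_index x"
  shows "last_index (prefix_at x j) = j"
    and "fst (prefix_at x j) = induced (fst x) (vertex_at x ` {1..j})"
    and "1 \<le> i \<Longrightarrow> i \<le> j \<Longrightarrow> vertex_at (prefix_at x j) i = vertex_at x i"
    and "i \<le> j \<Longrightarrow> bag_at (prefix_at x j) i = bag_at x i"
    and "i \<le> j \<Longrightarrow> prefix_at (prefix_at x j) i = prefix_at x i"
proof -
  note a = admissibleD[OF x]
  have "j < length (fst (snd x))" using j a(5) by simp
  note s = decomposition_prefix_selectors[OF a(1,3) this]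
  show "last_index (prefix_at x j) = j"
    "fst (prefix_at x j) = induced (fst x) (vertex_at x ` {1..j})"
    "1 \<le> i \<Longrightarrow> i \<le> j \<Longrightarrow> vertex_at (prefix_at x j) i = vertex_at x i"
    "i \<le> j \<Longrightarrow> bag_at (prefix_at x j) i = bag_at x i"
    "i \<le> j \<Longrightarrow> prefix_at (prefix_at x j) i = prefix_at x i"
    using s unfolding prefix_at_def bag_at_def by simp_all
qed

section \<open>The graph of inputs\<close>

text \<open>Oriented from the shorter to the longer input, so that an arc can be read inside the
  graph of its second end. The finite graphs \<open>\<Gamma>\<close> below use the symmetric
  closure.\<close>

definition prefix_arcs :: "('v, 'n) decomposed_graph rel" where
  "prefix_arcs = {(prefix_at y j, y) | y j. 1 \<le> j \<and> j < last_index y \<and>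
    (vertex_at y j, vertex_at y (last_index y)) \<in> parcs (fst y)}"

lemma prefix_arcsI:
  assumes "1 \<le> j" "j < last_index y"
    and "(vertex_at y j, vertex_at y (last_index y)) \<in> parcs (fst y)"
  shows "(prefix_at y j, y) \<in> prefix_arcs"
  using assms unfolding prefix_arcs_def by blast

lemma prefix_arcs_less:
  assumes "admissible k t y" "(x, y) \<in> prefix_arcs"
  shows "last_index x < last_index y" "x = prefix_at y (last_index x)"
    and "(vertex_at y (last_index x), vertex_at y (last_index y)) \<in> parcs (fst y)"
proof -
  obtain j where j: "j < last_index y" "x = prefix_at y j"
    "(vertex_at y j, vertex_at y (last_index y)) \<in> parcs (fst y)"
    using assms(2) by (auto simp: prefix_arcs_def)
  then have "last_index x = j" using prefix_at_selectors(1)[OF assms(1)] by simp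
  then show "last_index x < last_index y" "x = prefix_at y (last_index x)"
    "(vertex_at y (last_index x), vertex_at y (last_index y)) \<in> parcs (fst y)"
    using j by simp_all
qed

section \<open>Finite sets of inputs closed under prefixes\<close>

context
  fixes k t :: nat and F :: "('v, 'n) decomposed_graph set"
  assumes k: "0 < k" and F: "finite F" "\<And>x. x \<in> F \<Longrightarrow> admissible k t x"
    and closed: "\<And>x j. x \<in> F \<Longrightarrow> 1 \<le> j \<Longrightarrow> j \<le> last_index x \<Longrightarrow> prefix_at x j \<in> F"
begin

private definition \<Gamma> :: "('v, 'n) decomposed_graph pair_pre_digraph" where
  "\<Gamma> = \<lparr>pverts = F, parcs = Restr (prefix_arcs \<union> prefix_arcs\<inverse>) F\<rparr>"

private lemma arcs_less: "(x, y) \<in> prefix_arcs \<Longrightarrow> y \<in> F \<Longrightarrow> last_index x < last_index y"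
  using prefix_arcs_less(1) F(2) by blast

private lemma \<Gamma>_graph: "pair_graph \<Gamma>"
proof (rule pair_graphI)
  show "(x, x) \<notin> parcs \<Gamma>" for x
    using arcs_less[of x x] by (auto simp: \<Gamma>_def)
qed (use F(1) in \<open>auto simp: \<Gamma>_def\<close>)

text \<open>Each other member of a clique is adjacent to the longest member \<open>z\<close> and
  hence a prefix of it. A prefix of \<open>z\<close> is determined by its length, so the vertices
  introduced last by the members are distinct, and they form a clique of size \<open>k\<close> in
  the graph of \<open>z\<close>.\<close>

private lemma \<Gamma>_clique_free: "clique_free k \<Gamma>"
  unfolding clique_free_iff[OF \<Gamma>_graph]
proof
  assume "\<exists>X \<subseteq> pverts \<Gamma>. card X = k \<and> (\<forall>u \<in> X. \<forall>v \<in> X. u \<noteq> v \<longrightarrow> (u, v) \<in> parcs \<Gamma>)"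
  then obtain X where X: "X \<subseteq> F" "card X = k"
    "\<And>x y. x \<in> X \<Longrightarrow> y \<in> X \<Longrightarrow> x \<noteq> y \<Longrightarrow> (x, y) \<in> prefix_arcs \<or> (y, x) \<in> prefix_arcs"
    by (auto simp: \<Gamma>_def)
  \<comment> \<open>Positivity of \<open>k\<close> enters here: an empty clique has no longest
    member.\<close>
  have "finite X" "X \<noteq> {}" using X(1,2) F(1) k finite_subset by auto
  then have fin: "finite (last_index ` X)" "last_index ` X \<noteq> {}" by auto
  from Max_in[OF this] obtain z where z: "z \<in> X" "last_index z = Max (last_index ` X)" by auto
  have max: "last_index x \<le> last_index z" if "x \<in> X" for x
    unfolding z(2) using that fin by simp
  have zF: "admissible k t z" using F(2) X(1) z(1) by blast
  note az = admissibleD[OF zF]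
  have pre: "1 \<le> last_index x \<and> x = prefix_at z (last_index x)" if x: "x \<in> X" for x
  proof (cases "x = z")
    case True
    then show ?thesis using az(4,6) by simp
  next
    case False
    have "(z, x) \<notin> prefix_arcs" using arcs_less[of z x] max[OF x] x X(1) by auto
    then have "(x, z) \<in> prefix_arcs" using X(3)[OF x z(1) False] by blast
    moreover have "1 \<le> last_index x" using admissibleD(4) F(2) X(1) x by blast
    ultimately show ?thesis using prefix_arcs_less(2)[OF zF] by blast
  qed
  let ?f = "\<lambda>x. vertex_at z (last_index x)"
  have inj: "inj_on ?f X"
  proof (rule inj_onI)
    fix x y assume xy: "x \<in> X" "y \<in> X" "?f x = ?f y"
    then have "last_index x = last_index y"
      using nice_sequence_inj[OF az(3), of "last_index x" "last_index y"] pre max az(5) by (simp add: less_Suc_eq_le)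
    then show "x = y" using pre xy(1,2) by metis
  qed
  have "?f ` X \<subseteq> pverts (fst z)"
  proof -
    have "last_index x \<in> {1..length (fst (snd z)) - 1}" if "x \<in> X" for x
      using pre[OF that] max[OF that] az(5) by simp
    then show ?thesis unfolding nice_sequenceD(5)[OF az(3)] by blast
  qed
  moreover have "card (?f ` X) = k" using card_image[OF inj] X(2) by simp
  moreover have "(?f x, ?f y) \<in> parcs (fst z)" if xy: "x \<in> X" "y \<in> X" "?f x \<noteq> ?f y" for x y
  proof -
    have key: "(?f x, ?f y) \<in> parcs (fst z)" if xy: "x \<in> X" "y \<in> X" "(x, y) \<in> prefix_arcs" for x y
    proof -
      have y: "admissible k t y" using F(2) X(1) xy(2) by blast
      have yz: "y = prefix_at z (last_index y)" "last_index y \<le> last_index z" "1 \<le> last_index y"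
        using pre max xy(2) by auto
      note a = prefix_arcs_less[OF y xy(3)]
      note sel = prefix_at_selectors[OF zF yz(2), folded yz(1)]
      have "(vertex_at y (last_index x), vertex_at y (last_index y)) \<in> parcs (fst z)"
        using a(3) sel(2) by simp
      then show ?thesis using sel(3) a(1) pre[OF xy(1)] yz(3) by simp
    qed
    have "x \<noteq> y" using xy(3) by auto
    then show ?thesis using X(3) xy key pair_graphD(3)[OF az(1)] by blast
  qed
  ultimately show False using az(2) unfolding clique_free_iff[OF az(1)] by blast
qed

text \<open>The clique of \<open>x\<close> consists of the prefixes whose last vertex still lies in
  the last bag of \<open>x\<close>, so its size is at most that of a bag. The order is by length. A
  vertex of the last bag has been present ever since its introduction, which gives the elimination
  property; closure of \<open>F\<close> under prefixes keeps the cliques inside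
  \<open>F\<close>.\<close>

private lemma \<Gamma>_peo: "\<exists>rk B. peo \<Gamma> rk B t"
proof -
  obtain rk :: "_ \<Rightarrow> nat" where rk: "inj_on rk F"
    and rk_less: "\<And>x y. x \<in> F \<Longrightarrow> y \<in> F \<Longrightarrow> last_index x < last_index y \<Longrightarrow> rk x < rk y"
    using finite_tie_breaking[OF F(1), of last_index] by blast
  define J where "J x = {j \<in> {1..last_index x}. vertex_at x j \<in> bag_at x (last_index x)}" for x :: "('v, 'n) decomposed_graph"
  have "peo \<Gamma> rk (\<lambda>x. prefix_at x ` J x) t"
    unfolding peo_def
  proof (intro conjI ballI impI)
    show "inj_on rk (pverts \<Gamma>)" using rk by (simp add: \<Gamma>_def)
    fix x assume "x \<in> pverts \<Gamma>"
    then have x: "x \<in> F" "admissible k t x" using F(2) by (auto simp: \<Gamma>_def)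
    note a = admissibleD[OF x(2)] and sel = prefix_at_selectors[OF x(2)]
    have "last_index x \<in> J x"
      using a(4,5) nice_sequenceD(6)[OF a(3), of "last_index x"] by (simp add: J_def bag_at_def)
    then show "x \<in> prefix_at x ` J x" using a(6) by force
    show "prefix_at x ` J x \<subseteq> pverts \<Gamma>" using closed[OF x(1)] by (auto simp: J_def \<Gamma>_def)
    have "card (prefix_at x ` J x) \<le> card (J x)" by (rule card_image_le) (simp add: J_def)
    also have "\<dots> \<le> card (bag_at x (last_index x))"
    proof (rule card_inj_on_le)
      show "inj_on (vertex_at x) (J x)"
        by (rule inj_on_subset[OF nice_sequenceD(4)[OF a(3)]]) (auto simp: J_def a(5))
      show "vertex_at x ` J x \<subseteq> bag_at x (last_index x)" by (auto simp: J_def)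
      show "finite (bag_at x (last_index x))"
        using nice_sequence_bag[OF a(3), of "last_index x"] a(5) unfolding bag_at_def
        by (auto intro: finite_subset)
    qed
    also have "\<dots> \<le> Suc t" using a(7) by simp
    finally show "card (prefix_at x ` J x) \<le> Suc t" .
    fix w assume "w \<in> prefix_at x ` J x"
    then obtain i where i: "w = prefix_at x i" "i \<in> J x" by blast
    have wF: "w \<in> F" and li: "last_index w = i" "1 \<le> i" "i \<le> last_index x"
      using i closed[OF x(1)] sel(1) by (auto simp: J_def)
    show "rk w \<le> rk x"
    proof (cases "i = last_index x")
      case True
      then show ?thesis using i(1) a(6) by simp
    next
      case False
      then show ?thesis using rk_less[OF wF x(1)] li by simp
    qed
    fix u assume u: "u \<in> prefix_at x ` J x" "rk w \<le> rk u"
    then obtain j where j: "u = prefix_at x j" "j \<in> J x" by blast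
    have uF: "u \<in> F" and lj: "last_index u = j" "1 \<le> j" "j \<le> last_index x"
      using j closed[OF x(1)] sel(1) by (auto simp: J_def)
    have ij: "i \<le> j" using rk_less[OF uF wF] u(2) li lj by (meson leD leI)
    have "vertex_at x i \<in> bag_at x j"
      using nice_sequence_interval[OF a(3) li(2) ij lj(3)] i(2) a(5) by (simp add: J_def bag_at_def)
    then have "i \<in> J u" using sel(3,4)[OF lj(3)] li(2) ij lj(1) by (simp add: J_def j(1))
    moreover have "w = prefix_at u i" using sel(5)[OF lj(3) ij] i(1) j(1) by simp
    ultimately show "w \<in> prefix_at u ` J u" by blast
  next
    have key: "x \<in> prefix_at y ` J y" if xy: "x \<in> F" "y \<in> F" "(x, y) \<in> prefix_arcs" for x y
    proof -
      have y: "admissible k t y" using F(2) xy(2) .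
      note a = admissibleD[OF y] and l = prefix_arcs_less[OF y xy(3)]
      have "1 \<le> last_index x" using admissibleD(4) F(2) xy(1) by blast
      then have "last_index x \<in> J y"
        using nice_sequenceD(8)[OF a(3) _ l(1) _ l(3)] l(1) a(5) by (simp add: J_def bag_at_def)
      then show ?thesis using l(2) by blast
    qed
    fix e assume "e \<in> parcs \<Gamma>"
    then show "case e of (x, y) \<Rightarrow> x \<in> prefix_at y ` J y \<or> y \<in> prefix_at x ` J x"
      using key by (auto simp: \<Gamma>_def)
  qed
  then show ?thesis by blast
qed

lemma prefix_arcs_finite_coloring:
  assumes "c = max_chromatic_number TYPE('u::infinite) t k"
  shows "\<exists>\<phi>. (\<forall>x \<in> F. \<phi> x < c) \<and> (\<forall>x \<in> F. \<forall>y \<in> F. (x, y) \<in> prefix_arcs \<longrightarrow> \<phi> x \<noteq> \<phi> y)"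
proof -
  obtain rk B where "peo \<Gamma> rk B t" using \<Gamma>_peo by blast
  from peo_max_coloring[OF \<Gamma>_graph \<Gamma>_clique_free this assms]
  obtain \<phi> :: "('v, 'n) decomposed_graph \<Rightarrow> nat" where "\<And>x. x \<in> pverts \<Gamma> \<Longrightarrow> \<phi> x < c"
    "\<And>x y. (x, y) \<in> parcs \<Gamma> \<Longrightarrow> \<phi> x \<noteq> \<phi> y" by blast
  then show ?thesis by (intro exI[of _ \<phi>]) (auto simp: \<Gamma>_def)
qed

end

lemma prefix_arcs_coloring:
  assumes k: "0 < k" and c: "c = max_chromatic_number TYPE('u::infinite) t k"
  shows "\<exists>\<phi> :: ('v, 'n) decomposed_graph \<Rightarrow> nat. (\<forall>x. admissible k t x \<longrightarrow> \<phi> x < c) \<and>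
    (\<forall>x y. admissible k t x \<longrightarrow> admissible k t y \<longrightarrow> (x, y) \<in> prefix_arcs \<longrightarrow> \<phi> x \<noteq> \<phi> y)"
proof -
  let ?W = "Collect (admissible k t) :: ('v, 'n) decomposed_graph set"
  have finite_case: "\<exists>\<phi>. (\<forall>x \<in> F. \<phi> x < c) \<and> (\<forall>x \<in> F. \<forall>y \<in> F. (x, y) \<in> prefix_arcs \<longrightarrow> \<phi> x \<noteq> \<phi> y)"
    if F: "finite F" "F \<subseteq> ?W" for F
  proof -
    \<comment> \<open>The elimination ordering needs a prefix-closed set. Closing under prefixes
      keeps the set finite, since each input has finitely many prefixes.\<close>
    define F' where "F' = (\<Union>x \<in> F. prefix_at x ` {1..last_index x})"
    have adm: "admissible k t x" if x: "x \<in> F'" for x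
    proof -
      obtain y j where y: "y \<in> F" "1 \<le> j" "j \<le> last_index y" "x = prefix_at y j"
        using x by (auto simp: F'_def)
      then show ?thesis using F(2) admissibleD(8) by blast
    qed
    have "prefix_at y j \<in> F'" if y: "y \<in> F'" "1 \<le> j" "j \<le> last_index y" for y j
    proof -
      obtain x i where x: "x \<in> F" "1 \<le> i" "i \<le> last_index x" "y = prefix_at x i"
        using y(1) by (auto simp: F'_def)
      have "admissible k t x" using x(1) F(2) by blast
      then have "j \<le> i" "prefix_at y j = prefix_at x j"
        using prefix_at_selectors(1,5)[of k t x i] x(3,4) y(3) by auto
      then have "prefix_at y j \<in> prefix_at x ` {1..last_index x}" using x(3) y(2) by auto
      then show ?thesis using x(1) unfolding F'_def by blast
    qed
    moreover have "finite F'" using F(1) by (simp add: F'_def)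
    ultimately obtain \<phi> where \<phi>: "\<forall>x \<in> F'. \<phi> x < c"
      "\<forall>x \<in> F'. \<forall>y \<in> F'. (x, y) \<in> prefix_arcs \<longrightarrow> \<phi> x \<noteq> \<phi> y"
      using prefix_arcs_finite_coloring[OF k _ adm _ c, of F'] by blast
    have "F \<subseteq> F'"
    proof
      fix x assume "x \<in> F"
      then have "admissible k t x" using F(2) by blast
      from admissibleD(4,6)[OF this] show "x \<in> F'" using \<open>x \<in> F\<close> unfolding F'_def by force
    qed
    then show ?thesis using \<phi> by blast
  qed
  have "\<exists>\<phi>. (\<forall>x \<in> ?W. \<phi> x < c) \<and> (\<forall>x \<in> ?W. \<forall>y \<in> ?W. (x, y) \<in> prefix_arcs \<longrightarrow> \<phi> x \<noteq> \<phi> y)"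
    by (rule coloring_compactness) (rule finite_case)
  then show ?thesis unfolding mem_Collect_eq Ball_def by blast
qed

lemma optimal_online_algorithm:
  assumes k: "0 < k" and c: "c = max_chromatic_number TYPE('u::infinite) t k"
  shows "\<exists>A :: ('v, 'n) decomposed_graph \<Rightarrow> int. online_coloring_algorithm A \<and>
    (\<forall>H P \<beta>. pair_graph H \<and> clique_free k H \<and> nice_path_decomposition H P \<beta> \<and>
        decomposition_width (path_graph P) \<beta> \<le> int t \<longrightarrow>
      online_chromatic_number A H P \<beta> \<le> c)"
proof -
  obtain \<phi> :: "('v, 'n) decomposed_graph \<Rightarrow> nat" where \<phi>_lt: "\<And>x. admissible k t x \<Longrightarrow> \<phi> x < c"
    and \<phi>_neq: "\<And>x y. admissible k t x \<Longrightarrow> admissible k t y \<Longrightarrow> (x, y) \<in> prefix_arcs \<Longrightarrow> \<phi> x \<noteq> \<phi> y"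
    using prefix_arcs_coloring[OF k c, where 'v = 'v and 'n = 'n] by blast
  \<comment> \<open>On inadmissible inputs every vertex receives a color of its own.\<close>
  define A where "A x = int (if admissible k t x then \<phi> x else c + last_index x)" for x
  have "online_coloring_algorithm A"
    unfolding online_coloring_algorithm_def
  proof (intro allI impI, elim conjE)
    fix G :: "'v pair_pre_digraph" and P :: "'n list" and \<beta>
    assume G: "pair_graph G" and nice: "nice_path_decomposition G P \<beta>" and "length P - 1 \<ge> 1"
    define v where "v = introduced P \<beta>"
    have s: "nice_sequence G P \<beta> v"
      unfolding v_def by (rule nice_path_decomposition_sequence[OF G nice])
    let ?x = "decomposition_prefix G P \<beta>"
    have neq: "A (?x i) \<noteq> A (?x j)"
      if ij: "1 \<le> i" "i < j" "j < length P" "(v i, v j) \<in> parcs G" for i j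
    proof -
      have i: "i < length P" using ij by simp
      note si = decomposition_prefix_selectors[OF G s i] and sj = decomposition_prefix_selectors[OF G s ij(3)]
      \<comment> \<open>A prefix of an admissible input is admissible, so an admissible longer input
        makes both admissible and they are adjacent. Otherwise the longer input gets
        \<open>c + j\<close>, which exceeds every color below \<open>c\<close> and also
        \<open>c + i\<close>.\<close>
      show ?thesis
      proof (cases "admissible k t (?x j)")
        case True
        have pre: "prefix_at (?x j) i = ?x i" using sj(5) ij by simp
        then have "admissible k t (?x i)" using admissibleD(8)[OF True, of i] sj(1) ij by simp
        moreover have "(?x i, ?x j) \<in> prefix_arcs"
        proof -
          have "(vertex_at (?x j) i, vertex_at (?x j) (last_index (?x j))) \<in> parcs (fst (?x j))"
            using sj(1-3) ij by simp
          then show ?thesis using prefix_arcsI[of i "?x j"] pre sj(1) ij by simp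
        qed
        ultimately show ?thesis using \<phi>_neq True by (simp add: A_def)
      next
        case False
        then show ?thesis using \<phi>_lt[of "?x i"] si(1) sj(1) ij by (auto simp: A_def)
      qed
    qed
    show "proper_coloring G (produced_coloring A G P \<beta>)"
      unfolding proper_coloring_def
    proof (clarify)
      fix a b assume ab: "(a, b) \<in> parcs G" and eq: "produced_coloring A G P \<beta> a = produced_coloring A G P \<beta> b"
      have ba: "(b, a) \<in> parcs G" "a \<noteq> b" using ab pair_graphD(3,4)[OF G] by auto
      have "a \<in> pverts G" "b \<in> pverts G" using ab pair_graphD(2)[OF G] by auto
      then obtain i j where ij: "i \<in> {1..length P - 1}" "j \<in> {1..length P - 1}" "a = v i" "b = v j"
        unfolding nice_sequenceD(5)[OF s] by blast
      then have range: "1 \<le> i" "i < length P" "1 \<le> j" "j < length P" by auto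
      then have "A (?x i) = A (?x j)" using eq ij produced_coloring_eq[OF s] by simp
      moreover have "i < j \<or> j < i" using ba(2) ij by (cases i j rule: linorder_cases) auto
      ultimately show False using neq[of i j] neq[of j i] ab ba(1) ij(3,4) range by auto
    qed
  qed
  moreover have "online_chromatic_number A H P \<beta> \<le> c"
    if H: "pair_graph H" "clique_free k H" "nice_path_decomposition H P \<beta>"
      and width: "decomposition_width (path_graph P) \<beta> \<le> int t" for H P \<beta>
  proof -
    define v where "v = introduced P \<beta>"
    have s: "nice_sequence H P \<beta> v"
      unfolding v_def by (rule nice_path_decomposition_sequence[OF H(1,3)])
    have "produced_coloring A H P \<beta> u \<in> {0..<int c}" if u: "u \<in> pverts H" for u
    proof -
      obtain j where j: "1 \<le> j" "j < length P" "u = v j"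
        using u unfolding nice_sequenceD(5)[OF s] by auto
      have "admissible k t (decomposition_prefix H P \<beta> j)"
        by (rule admissible_decomposition_prefix[OF H(1,2) s width j(1,2)])
      then show ?thesis using \<phi>_lt produced_coloring_eq[OF s j(1,2)] by (simp add: j(3) A_def)
    qed
    then have "card (produced_coloring A H P \<beta> ` pverts H) \<le> card {0..<int c}"
      by (intro card_mono) auto
    then show ?thesis by (simp add: online_chromatic_number_def num_colors_def)
  qed
  ultimately show ?thesis by blast
qed

theorem lemma5:
  fixes t k c :: nat
  assumes "t > 0" and "k > 0"
    and "c = max_chromatic_number TYPE('v::infinite) t k"
  shows "(\<exists>A :: ('v, 'n::infinite) decomposed_graph \<Rightarrow> int. online_coloring_algorithm A \<and>
      (\<forall>H P \<beta>. pair_graph H \<and> clique_free k H \<and> nice_path_decomposition H P \<beta> \<and>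
          decomposition_width (path_graph P) \<beta> \<le> int t \<longrightarrow>
        online_chromatic_number A H P \<beta> \<le> c)) \<and>
    (\<forall>(A' :: ('v, 'n) decomposed_graph \<Rightarrow> int) c' :: nat.
      online_coloring_algorithm A' \<and>
      (\<forall>H P \<beta>. pair_graph H \<and> clique_free k H \<and> nice_path_decomposition H P \<beta> \<and>
          decomposition_width (path_graph P) \<beta> \<le> int t \<longrightarrow>
        online_chromatic_number A' H P \<beta> \<le> c') \<longrightarrow>
      (\<forall>G :: 'v pair_pre_digraph. pair_graph G \<and> clique_free k G \<and> tree_width G \<le> int t \<longrightarrow>
        chromatic_number G \<le> c'))"
proof (intro conjI allI impI; (elim conjE)?)
  show "\<exists>A :: ('v, 'n) decomposed_graph \<Rightarrow> int. online_coloring_algorithm A \<and>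
      (\<forall>H P \<beta>. pair_graph H \<and> clique_free k H \<and> nice_path_decomposition H P \<beta> \<and>
          decomposition_width (path_graph P) \<beta> \<le> int t \<longrightarrow>
        online_chromatic_number A H P \<beta> \<le> c)"
    by (rule optimal_online_algorithm[OF assms(2,3)])
next
  fix A' :: "('v, 'n) decomposed_graph \<Rightarrow> int" and c' :: nat and G :: "'v pair_pre_digraph"
  assume A': "online_coloring_algorithm A'"
    "\<forall>H P \<beta>. pair_graph H \<and> clique_free k H \<and> nice_path_decomposition H P \<beta> \<and>
      decomposition_width (path_graph P) \<beta> \<le> int t \<longrightarrow> online_chromatic_number A' H P \<beta> \<le> c'"
    and G: "pair_graph G" "clique_free k G" "tree_width G \<le> int t"
  obtain rk B where peo: "peo G rk B t" using tree_width_le_iff_peo[OF G(1)] G(3) by blast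
  \<comment> \<open>Root paths may have any length, so their nodes are drawn from an injection of
    the naturals into the node type.\<close>
  obtain e :: "nat \<Rightarrow> 'n" where e: "inj e" using infinite_countable_subset[OF infinite_UNIV] by blast
  show "chromatic_number G \<le> c'"
    using chromatic_number_le_online[OF G(1) peo e G(2) A'(1)] A'(2) by blast
qed

end
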